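(* There are no decision procedures which test Büchi-recognizable $\omega$-picture languages for E-recognizability, respectively for A-recognizability. That is: there is no algorithm which, given a finite alphabet $\Sigma$ and a Büchi tiling system $(\mathcal{A},F)$ over $\Sigma$ as input, decides whether the language $L\subseteq\Sigma^{\omega,\omega}$ Büchi-recognized by $(\mathcal{A},F)$ is E-recognizable; and there is no algorithm which, given the same input, decides whether $L$ is A-recognizable.
   Context: Let $\Sigma$ be a finite alphabet, $\#\notin\Sigma$ a border letter, $\hat{\Sigma}=\Sigma\cup\{\#\}$. An $\omega$-picture over $\Sigma$ is a function $p:\omega\times\omega\to\hat{\Sigma}$ with $p(i,0)=p(0,i)=\#$ for all $i\ge0$ and $p(i,j)\in\Sigma$ for all $i,j>0$; $\Sigma^{\omega,\omega}$ is the set of $\omega$-pictures over $\Sigma$. A tiling system is $\mathcal{A}=(Q,\Sigma,\Delta)$ with $Q$ a finite set of states and $\Delta\subseteq(\hat{\Sigma}\times Q)^4$ a finite set of tiles. A run of $\mathcal{A}$ on $p\in\Sigma^{\omega,\omega}$ is a map $\rho:\omega\times\omega\to Q$ such that for all $(i,j)\in\omega\times\omega$ the tile $$\left(\begin{array}{cc}(p(i,j+1),\rho(i,j+1))&(p(i+1,j+1),\rho(i+1,j+1))\\(p(i,j),\rho(i,j))&(p(i+1,j),\rho(i+1,j))\end{array}\right)$$ belongs to $\Delta$. A Büchi tiling system is a pair $(\mathcal{A},F)$ with $\mathcal{A}$ a tiling system and $F\subseteq Q$. The language A-recognized (respectively E-recognized, Büchi-recognized) by $(\mathcal{A},F)$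 is the set of $p\in\Sigma^{\omega,\omega}$ for which there is a run $\rho$ of $\mathcal{A}$ on $p$ with $\rho(v)\in F$ for all (respectively for at least one, for infinitely many) $v\in\omega\times\omega$. A language $L\subseteq\Sigma^{\omega,\omega}$ is A-recognizable (respectively E-recognizable, Büchi-recognizable) if it is A-recognized (respectively E-recognized, Büchi-recognized) by some such pair $(\mathcal{A},F)$. *)

theory Defs
  imports Main "HOL-Library.Nat_Bijection"
begin

section \<open>Partial recursive functions\<close>

datatype recf =
    Zero
  | Succ
  | Proj nat
  | Comp recf "recf list"
  | PrimRec recf recf
  | Mu recf

text \<open>
  \<open>rec_eval f xs y\<close>: the partial recursive function denoted by \<open>f\<close> is defined on the
  argument list \<open>xs\<close> and has value \<open>y\<close> there. Arities are not tracked: basic functions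
  ignore surplus arguments and are undefined if arguments are missing. The recursion argument
  of \<open>PrimRec\<close> and the search variable of \<open>Mu\<close> come first in the list; \<open>Mu\<close> is
  unbounded minimisation, which requires definedness below the least zero.
\<close>

inductive rec_eval :: "recf \<Rightarrow> nat list \<Rightarrow> nat \<Rightarrow> bool" where
  zero: "rec_eval Zero xs 0"
| succ: "rec_eval Succ (x # xs) (Suc x)"
| proj: "i < length xs \<Longrightarrow> rec_eval (Proj i) xs (xs ! i)"
| comp: "list_all2 (\<lambda>g y. rec_eval g xs y) gs ys \<Longrightarrow> rec_eval f ys z
    \<Longrightarrow> rec_eval (Comp f gs) xs z"
| prim_0: "rec_eval f xs y \<Longrightarrow> rec_eval (PrimRec f g) (0 # xs) y"
| prim_Suc: "rec_eval (PrimRec f g) (n # xs) y \<Longrightarrow> rec_eval g (n # y # xs) z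
    \<Longrightarrow> rec_eval (PrimRec f g) (Suc n # xs) z"
| mu: "rec_eval f (n # xs) 0 \<Longrightarrow> (\<forall>m<n. \<exists>y. rec_eval f (m # xs) (Suc y))
    \<Longrightarrow> rec_eval (Mu f) xs n"

inductive_cases rec_eval_elims:
  "rec_eval Zero xs z" "rec_eval Succ xs z" "rec_eval (Proj i) xs z"
  "rec_eval (Comp f gs) xs z" "rec_eval (PrimRec f g) (0 # xs) z"
  "rec_eval (PrimRec f g) (Suc n # xs) z" "rec_eval (Mu f) xs z"

lemma rec_eval_deterministic:
  "rec_eval f xs y \<Longrightarrow> rec_eval f xs z \<Longrightarrow> y = z"
proof (induction arbitrary: z rule: rec_eval.induct)
  case (zero xs)
  then show ?case by (rule rec_eval_elims(1)) simp
next
  case (succ x xs)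
  then show ?case by (rule rec_eval_elims(2)) simp
next
  case (proj i xs)
  from proj.prems show ?case by (rule rec_eval_elims(3)) simp
next
  case (comp xs gs ys f w)
  from comp.prems obtain ys' where
    ys': "list_all2 (\<lambda>g y. rec_eval g xs y) gs ys'" and f: "rec_eval f ys' z"
    by (rule rec_eval_elims(4))
  have len: "length gs = length ys" "length gs = length ys'"
    using comp.IH(1) ys' by (blast dest: list_all2_lengthD)+
  have "ys = ys'"
  proof (rule nth_equalityI)
    show "length ys = length ys'" using len by simp
    show "ys ! i = ys' ! i" if "i < length ys" for i
    proof -
      have "rec_eval (gs ! i) xs (ys' ! i)"
        using list_all2_nthD2[OF ys', of i] that len by simp
      then show ?thesis
        using list_all2_nthD2[OF comp.IH(1) that] by blast
    qed
  qed
  with f comp.IH(2) show ?case by blast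
next
  case (prim_0 f xs y g)
  from prim_0.prems have "rec_eval f xs z" by (rule rec_eval_elims(5))
  then show ?case by (rule prim_0.IH)
next
  case (prim_Suc f g n xs y w)
  from prim_Suc.prems obtain y' where
    y': "rec_eval (PrimRec f g) (n # xs) y'" and z: "rec_eval g (n # y' # xs) z"
    by (rule rec_eval_elims(6))
  from y' have "y = y'" by (rule prim_Suc.IH(1))
  with z show ?case using prim_Suc.IH(2) by blast
next
  case (mu f n xs)
  from mu.prems have z: "rec_eval f (z # xs) 0"
    and below: "\<forall>m<z. \<exists>y. rec_eval f (m # xs) (Suc y)"
    by (rule rec_eval_elims(7), blast)+
  have "\<not> z < n" using mu.IH(2) z by blast
  moreover have "\<not> n < z" using mu.IH(1) below by blast
  ultimately show ?case by simp
qed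

text \<open>
  \<open>d\<close> halts with the correct answer (1 for yes, 0 for no) on the code of every instance in
  \<open>I\<close>; nothing is required of it on numbers that are not codes of instances.
\<close>

definition decision_procedure :: "recf \<Rightarrow> 'i set \<Rightarrow> ('i \<Rightarrow> nat) \<Rightarrow> ('i \<Rightarrow> bool) \<Rightarrow> bool" where
  "decision_procedure d I code P \<longleftrightarrow> (\<forall>x\<in>I. rec_eval d [code x] (if P x then 1 else 0))"


section \<open>Pictures and tiling systems\<close>

text \<open>
  Letters of the bordered alphabet are of type \<open>'a option\<close>, with \<open>None\<close> as the border
  letter. In a position \<open>(i, j)\<close> the first coordinate is horizontal and the second vertical.
\<close>

definition bordered :: "'a set \<Rightarrow> 'a option set" where
  "bordered \<Sigma> = insert None (Some ` \<Sigma>)"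

type_synonym 'a picture = "nat \<times> nat \<Rightarrow> 'a option"

definition omega_pictures :: "'a set \<Rightarrow> 'a picture set" where
  "omega_pictures \<Sigma> =
    {p. (\<forall>i. p (i, 0) = None \<and> p (0, i) = None) \<and> (\<forall>i>0. \<forall>j>0. p (i, j) \<in> Some ` \<Sigma>)}"

type_synonym ('a, 'q) cell = "'a option \<times> 'q"

text \<open>Entries of a tile: top left, top right, bottom left, bottom right.\<close>

type_synonym ('a, 'q) tile =
  "('a, 'q) cell \<times> ('a, 'q) cell \<times> ('a, 'q) cell \<times> ('a, 'q) cell"

record ('a, 'q) tiling_system =
  states :: "'q set"
  alphabet :: "'a set"
  tiles :: "('a, 'q) tile set"

definition tiling_system :: "('a, 'q) tiling_system \<Rightarrow> bool" where
  "tiling_system A \<longleftrightarrow> finite (states A) \<and> finite (alphabet A) \<and>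
    (let C = bordered (alphabet A) \<times> states A in tiles A \<subseteq> C \<times> C \<times> C \<times> C)"

definition is_run :: "('a, 'q) tiling_system \<Rightarrow> 'a picture \<Rightarrow> (nat \<times> nat \<Rightarrow> 'q) \<Rightarrow> bool" where
  "is_run A p \<rho> \<longleftrightarrow> range \<rho> \<subseteq> states A \<and>
    (\<forall>i j. ((p (i, j + 1), \<rho> (i, j + 1)), (p (i + 1, j + 1), \<rho> (i + 1, j + 1)),
            (p (i, j), \<rho> (i, j)), (p (i + 1, j), \<rho> (i + 1, j))) \<in> tiles A)"

text \<open>A tiling system together with a set of final states, for any of the acceptance modes.\<close>

definition accepting_system :: "('a, 'q) tiling_system \<times> 'q set \<Rightarrow> bool" where
  "accepting_system = (\<lambda>(A, F). tiling_system A \<and> F \<subseteq> states A)"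

definition A_language :: "('a, 'q) tiling_system \<times> 'q set \<Rightarrow> 'a picture set" where
  "A_language = (\<lambda>(A, F). {p \<in> omega_pictures (alphabet A).
     \<exists>\<rho>. is_run A p \<rho> \<and> (\<forall>v. \<rho> v \<in> F)})"

definition E_language :: "('a, 'q) tiling_system \<times> 'q set \<Rightarrow> 'a picture set" where
  "E_language = (\<lambda>(A, F). {p \<in> omega_pictures (alphabet A).
     \<exists>\<rho>. is_run A p \<rho> \<and> (\<exists>v. \<rho> v \<in> F)})"

definition Buchi_language :: "('a, 'q) tiling_system \<times> 'q set \<Rightarrow> 'a picture set" where
  "Buchi_language = (\<lambda>(A, F). {p \<in> omega_pictures (alphabet A).
     \<exists>\<rho>. is_run A p \<rho> \<and> infinite {v. \<rho> v \<in> F}})"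

text \<open>
  States may be taken to be natural numbers without loss of generality, since the state sets
  are arbitrary finite sets.
\<close>

definition A_recognizable :: "'a set \<Rightarrow> 'a picture set \<Rightarrow> bool" where
  "A_recognizable \<Sigma> L \<longleftrightarrow> (\<exists>(A :: ('a, nat) tiling_system) F.
     accepting_system (A, F) \<and> alphabet A = \<Sigma> \<and> L = A_language (A, F))"

definition E_recognizable :: "'a set \<Rightarrow> 'a picture set \<Rightarrow> bool" where
  "E_recognizable \<Sigma> L \<longleftrightarrow> (\<exists>(A :: ('a, nat) tiling_system) F.
     accepting_system (A, F) \<and> alphabet A = \<Sigma> \<and> L = E_language (A, F))"


section \<open>Tiling systems as inputs of algorithms\<close>

text \<open>
  As inputs, alphabets and state sets are finite sets of natural numbers. Finite sets are coded
  by \<^const>\<open>set_encode\<close> (bit masks) and tuples by \<^const>\<open>prod_encode\<close>.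
\<close>

fun letter_code :: "nat option \<Rightarrow> nat" where
  "letter_code None = 0"
| "letter_code (Some a) = Suc a"

fun cell_code :: "(nat, nat) cell \<Rightarrow> nat" where
  "cell_code (a, q) = prod_encode (letter_code a, q)"

fun tile_code :: "(nat, nat) tile \<Rightarrow> nat" where
  "tile_code (c1, c2, c3, c4) =
     prod_encode (cell_code c1, prod_encode (cell_code c2,
       prod_encode (cell_code c3, cell_code c4)))"

fun system_code :: "(nat, nat) tiling_system \<times> nat set \<Rightarrow> nat" where
  "system_code (A, F) =
     prod_encode (set_encode (alphabet A), prod_encode (set_encode (states A),
       prod_encode (set_encode (tile_code ` tiles A), set_encode F)))"

lemma inj_letter_code: "inj letter_code"
proof (rule injI)
  show "x = y" if "letter_code x = letter_code y" for x y
    using that by (cases x; cases y) auto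
qed

lemma inj_tile_code: "inj tile_code"
  by (rule injI) (auto simp: inj_eq[OF inj_letter_code])

lemma finite_tiles: "tiling_system A \<Longrightarrow> finite (tiles A)"
  unfolding tiling_system_def bordered_def Let_def
  by (elim conjE) (erule finite_subset, simp)

text \<open>Different instances have different codes.\<close>

lemma inj_on_system_code:
  "inj_on system_code {X. accepting_system X}"
proof (rule inj_onI)
  fix X Y :: "(nat, nat) tiling_system \<times> nat set"
  assume X: "X \<in> {X. accepting_system X}" and Y: "Y \<in> {X. accepting_system X}"
    and eq: "system_code X = system_code Y"
  obtain A F where XA: "X = (A, F)" by fastforce
  obtain B G where YB: "Y = (B, G)" by fastforce
  have fin: "finite (alphabet A)" "finite (states A)" "finite (tiles A)" "finite F"
    "finite (alphabet B)" "finite (states B)" "finite (tiles B)" "finite G"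
    using X Y unfolding XA YB
    by (auto simp: accepting_system_def finite_tiles)
       (auto simp: tiling_system_def dest: finite_subset)
  have "alphabet A = alphabet B" "states A = states B"
    "tile_code ` tiles A = tile_code ` tiles B" "F = G"
    using eq fin unfolding XA YB by (auto simp: set_encode_eq)
  moreover from this have "tiles A = tiles B"
    by (simp add: inj_image_eq_iff[OF inj_tile_code])
  ultimately show "X = Y" unfolding XA YB by simp
qed

end

theory Submission
  imports Defs "HOL-Library.Diagonal_Subsequence" "HOL-Library.Infinite_Set"
begin

text \<open>
  A counter program with input \<open>c\<close> is simulated by a tiling system: row \<open>t + 1\<close> of a run spells out
  the configuration after \<open>t\<close> steps, with the registers in unary. If the program halts, there is no
  run and the language is empty, hence A- and E-recognizable. If it diverges, the language contains
  a picture of a certain shape iff column 1 carries infinitely many ones. E-recognizable languages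
  are \<open>F\<^sub>\<sigma>\<close> by compactness, so by a Baire category argument this one is neither E-recognizable nor
  A-recognizable.

  Given a decision procedure, the function that maps \<open>c\<close>, the code of a set of tiles, to the answer on
  the system formed by these tiles with input \<open>c\<close> is recursive, hence computed by a counter program.
  The program that afterwards halts iff the answer is no yields a contradiction on the code of its
  own tiles. Only the compilation of the program into tiles need not be computable here.
\<close>

section \<open>Counter programs\<close>

datatype instr =
    Incr nat
  | Decr nat
  | Copy nat nat
  | Clear nat
  | While nat "instr list"

type_synonym program = "instr list"
type_synonym config = "program \<times> (nat \<Rightarrow> nat)"

text \<open>The remaining program serves as the control state: entering a loop puts its body in
  front of the loop. A halted configuration is a fixed point.\<close>

fun step :: "config \<Rightarrow> config" where
  "step ([], r) = ([], r)"
| "step (Incr i # k, r) = (k, r(i := Suc (r i)))"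
| "step (Decr i # k, r) = (k, r(i := r i - 1))"
| "step (Copy i j # k, r) = (k, r(i := r j))"
| "step (Clear i # k, r) = (k, r(i := 0))"
| "step (While i c # k, r) = (if r i = 0 then k else c @ While i c # k, r)"

text \<open>Quantifying over the continuation \<open>k\<close> is what makes fragments composable,
  in particular loop bodies that are followed by their own loop.\<close>

definition runs :: "program \<Rightarrow> (nat \<Rightarrow> nat) \<Rightarrow> (nat \<Rightarrow> nat) \<Rightarrow> bool" where
  "runs p r r' \<longleftrightarrow> (\<forall>k. \<exists>m. (step ^^ m) (p @ k, r) = (k, r'))"

lemma runs_Nil: "runs [] r r"
  unfolding runs_def by (auto intro: exI[of _ 0])

lemma runs_append:
  assumes "runs p r r'" and "runs q r' r''"
  shows "runs (p @ q) r r''"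
  unfolding runs_def
proof
  fix k
  obtain m where m: "(step ^^ m) (p @ q @ k, r) = (q @ k, r')"
    using assms(1) unfolding runs_def by blast
  obtain n where "(step ^^ n) (q @ k, r') = (k, r'')"
    using assms(2) unfolding runs_def by blast
  with m have "(step ^^ (n + m)) ((p @ q) @ k, r) = (k, r'')"
    by (simp add: funpow_add)
  then show "\<exists>m. (step ^^ m) ((p @ q) @ k, r) = (k, r'')" ..
qed

lemma runs_step:
  assumes "\<And>k. step (a # k, r) = (p @ k, r')" and "runs p r' r''"
  shows "runs [a] r r''"
  unfolding runs_def
proof
  fix k
  obtain m where "(step ^^ m) (p @ k, r') = (k, r'')"
    using assms(2) unfolding runs_def by blast
  then have "(step ^^ Suc m) ([a] @ k, r) = (k, r'')"
    using assms(1)[of k] by (simp add: funpow_swap1)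
  then show "\<exists>m. (step ^^ m) ([a] @ k, r) = (k, r'')" ..
qed

lemma runs_Cons:
  assumes "\<And>k. step (a # k, r) = (k, r')" and "runs p r' r''"
  shows "runs (a # p) r r''"
  using runs_append[OF runs_step[of a r "[]", OF _ runs_Nil] assms(2)] assms(1) by simp

lemma runs_While_zero: "r i = 0 \<Longrightarrow> runs [While i c] r r"
  by (rule runs_step[of _ _ "[]", OF _ runs_Nil]) simp

lemma runs_While_pos:
  assumes "r i \<noteq> 0" and "runs c r r'" and "runs [While i c] r' r''"
  shows "runs [While i c] r r''"
  by (rule runs_step[of _ _ "c @ [While i c]" r]) (use assms in \<open>auto intro: runs_append\<close>)

lemma runs_Nil_iff: "runs [] r r' \<longleftrightarrow> r' = r"
proof
  assume "runs [] r r'"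
  then obtain m where "(step ^^ m) ([], r) = ([], r')"
    unfolding runs_def by fastforce
  moreover have "(step ^^ m) ([], r) = ([], r)" by (induction m) auto
  ultimately show "r' = r" by simp
qed (simp add: runs_Nil)

lemma runs_Cons_iff:
  assumes "\<And>k. step (a # k, r) = (k, r')"
  shows "runs (a # p) r r'' \<longleftrightarrow> runs p r' r''"
proof
  assume *: "runs (a # p) r r''"
  show "runs p r' r''"
    unfolding runs_def
  proof
    fix k
    obtain m where m: "(step ^^ m) ((a # p) @ k, r) = (k, r'')"
      using * unfolding runs_def by blast
    \<comment> \<open>\<open>m = 0\<close> would equate \<open>(a # p) @ k\<close> with the shorter
      program \<open>k\<close>.\<close>
    then obtain n where "m = Suc n" by (cases m) auto
    with m assms show "\<exists>m. (step ^^ m) (p @ k, r') = (k, r'')"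
      by (auto simp: funpow_swap1)
  qed
qed (blast intro: runs_Cons assms)

text \<open>Together with \<open>runs_Nil_iff\<close>, these equivalences let the simplifier execute
  straight-line code symbolically.\<close>

lemma runs_basic:
  "runs (Incr i # p) r r' \<longleftrightarrow> runs p (r(i := Suc (r i))) r'"
  "runs (Decr i # p) r r' \<longleftrightarrow> runs p (r(i := r i - 1)) r'"
  "runs (Copy i j # p) r r' \<longleftrightarrow> runs p (r(i := r j)) r'"
  "runs (Clear i # p) r r' \<longleftrightarrow> runs p (r(i := 0)) r'"
  by (rule runs_Cons_iff, simp)+

section \<open>Recursive functions as counter programs\<close>

text \<open>The arguments are read from the registers \<open>rs\<close>, and registers from \<open>n\<close> on are scratch.\<close>

definition computes :: "program \<Rightarrow> recf \<Rightarrow> nat list \<Rightarrow> nat \<Rightarrow> nat \<Rightarrow> bool" where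
  "computes p f rs out n \<longleftrightarrow> (\<forall>r y. rec_eval f (map r rs) y \<longrightarrow>
     (\<exists>r'. runs p r r' \<and> r' out = y \<and> (\<forall>j<n. j \<noteq> out \<longrightarrow> r' j = r j)))"

text \<open>Quantifying over all register layouts replaces any renaming of registers: a caller asks
  for a subprogram whose scratch space begins above the registers it wants kept.\<close>

definition implementable :: "recf \<Rightarrow> bool" where
  "implementable f \<longleftrightarrow> (\<forall>rs out n. set rs \<subseteq> {..<n} \<longrightarrow> out < n \<longrightarrow> out \<notin> set rs \<longrightarrow>
     (\<exists>p. computes p f rs out n))"

lemma implementableE:
  assumes "implementable f" and "set rs \<subseteq> {..<n}" and "out < n" and "out \<notin> set rs"
  obtains p where "computes p f rs out n"
  using assms unfolding implementable_def by blast

lemma computesE: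
  assumes "computes p f rs out n" and "rec_eval f (map r rs) y"
  obtains r' where "runs p r r'" and "r' out = y" and "\<forall>j<n. j \<noteq> out \<longrightarrow> r' j = r j"
  using assms unfolding computes_def by blast

lemma implementable_Zero: "implementable Zero"
proof -
  have "computes [Clear out] Zero rs out n" for rs out n
    unfolding computes_def
    by (auto elim!: rec_eval_elims(1) simp: runs_basic runs_Nil_iff)
  then show ?thesis unfolding implementable_def by blast
qed

lemma implementable_Succ: "implementable Succ"
proof -
  have "computes [Copy out (hd rs), Incr out] Succ rs out n" for rs out n
    unfolding computes_def
    by (auto elim!: rec_eval_elims(2) simp: runs_basic runs_Nil_iff hd_map)
  then show ?thesis unfolding implementable_def by blast
qed

lemma implementable_Proj: "implementable (Proj i)"
proof -
  have "computes [Copy out (rs ! i)] (Proj i) rs out n" for rs out n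
    unfolding computes_def
    by (auto elim!: rec_eval_elims(3) simp: runs_basic runs_Nil_iff)
  then show ?thesis unfolding implementable_def by blast
qed

text \<open>The results are collected in the block starting at \<open>n\<close>. Each further
  program gets a bound larger by one, so it preserves the arguments and the results already
  stored.\<close>

lemma computes_list:
  assumes "\<forall>g\<in>set gs. implementable g" and "set rs \<subseteq> {..<n}"
  shows "\<exists>p. \<forall>r ys. list_all2 (\<lambda>g y. rec_eval g (map r rs) y) gs ys \<longrightarrow>
    (\<exists>r'. runs p r r' \<and> map r' [n..<n + length gs] = ys \<and> (\<forall>j<n. r' j = r j))"
  using assms
proof (induction gs arbitrary: n)
  case Nil
  have "\<forall>r ys. list_all2 (\<lambda>g y. rec_eval g (map r rs) y) [] ys \<longrightarrow>
    (\<exists>r'. runs [] r r' \<and> map r' [n..<n + length []] = ys \<and> (\<forall>j<n. r' j = r j))"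
    by (simp add: runs_Nil_iff)
  then show ?case by (rule exI)
next
  case (Cons g gs)
  then have rs: "set rs \<subseteq> {..<Suc n}" "n \<notin> set rs" by auto
  have "implementable g" and gs: "\<forall>g\<in>set gs. implementable g" using Cons.prems(1) by auto
  then obtain p where p: "computes p g rs n (Suc n)"
    using implementableE[OF _ rs(1) _ rs(2)] by blast
  obtain q where q: "\<forall>r ys. list_all2 (\<lambda>g y. rec_eval g (map r rs) y) gs ys \<longrightarrow>
      (\<exists>r'. runs q r r' \<and> map r' [Suc n..<Suc n + length gs] = ys \<and> (\<forall>j<Suc n. r' j = r j))"
    using Cons.IH[OF gs rs(1)] by (rule exE)
  have "\<exists>r'. runs (p @ q) r r' \<and> map r' [n..<n + length (g # gs)] = ys \<and> (\<forall>j<n. r' j = r j)"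
    if "list_all2 (\<lambda>g y. rec_eval g (map r rs) y) (g # gs) ys" for r ys
  proof -
    from that obtain y zs where ys: "ys = y # zs" and y: "rec_eval g (map r rs) y"
      and zs: "list_all2 (\<lambda>g y. rec_eval g (map r rs) y) gs zs"
      by (auto simp: list_all2_Cons1)
    obtain r1 where r1: "runs p r r1" "r1 n = y" and "\<forall>j<Suc n. j \<noteq> n \<longrightarrow> r1 j = r j"
      by (rule computesE[OF p y])
    then have r1_eq: "\<forall>j<n. r1 j = r j" by simp
    then have eq: "map r1 rs = map r rs" using Cons.prems(2) by (simp add: subset_eq)
    obtain r2 where r2: "runs q r1 r2" "map r2 [Suc n..<Suc n + length gs] = zs"
      "\<forall>j<Suc n. r2 j = r1 j"
      using q[rule_format, of r1 zs] zs unfolding eq by blast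
    have "[n..<n + length (g # gs)] = n # [Suc n..<Suc n + length gs]"
      by (simp add: upt_conv_Cons del: upt_Suc)
    then have "map r2 [n..<n + length (g # gs)] = ys"
      using r1(2) r2(2,3) by (simp del: upt_Suc add: ys)
    moreover have "\<forall>j<n. r2 j = r j" using r1_eq r2(3) by simp
    ultimately show ?thesis using runs_append[OF r1(1) r2(1)] by blast
  qed
  then show ?case by blast
qed

lemma implementable_Comp:
  assumes f: "implementable f" and gs: "\<forall>g\<in>set gs. implementable g"
  shows "implementable (Comp f gs)"
  unfolding implementable_def
proof (intro allI impI)
  fix rs :: "nat list" and out n :: nat
  assume rs: "set rs \<subseteq> {..<n}" and out: "out < n" "out \<notin> set rs"
  obtain q where q: "\<And>r ys. list_all2 (\<lambda>g y. rec_eval g (map r rs) y) gs ys \<Longrightarrow>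
      \<exists>r'. runs q r r' \<and> map r' [n..<n + length gs] = ys \<and> (\<forall>j<n. r' j = r j)"
    using computes_list[OF gs rs] by blast
  have "set [n..<n + length gs] \<subseteq> {..<n + length gs}" "out \<notin> set [n..<n + length gs]"
    using out by auto
  then obtain p where p: "computes p f [n..<n + length gs] out (n + length gs)"
    using implementableE[OF f] out(1) trans_less_add1 by metis
  have "computes (q @ p) (Comp f gs) rs out n"
    unfolding computes_def
  proof (intro allI impI)
    fix r y assume "rec_eval (Comp f gs) (map r rs) y"
    then obtain ys where ys: "list_all2 (\<lambda>g y. rec_eval g (map r rs) y) gs ys"
      and y: "rec_eval f ys y"
      by (rule rec_eval_elims(4))
    obtain r1 where r1: "runs q r r1" "map r1 [n..<n + length gs] = ys" "\<forall>j<n. r1 j = r j"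
      using q[OF ys] by (elim exE conjE)
    from y have "rec_eval f (map r1 [n..<n + length gs]) y" unfolding r1(2) .
    then obtain r2 where r2: "runs p r1 r2" "r2 out = y"
      "\<forall>j<n + length gs. j \<noteq> out \<longrightarrow> r2 j = r1 j"
      by (rule computesE[OF p])
    have "\<forall>j<n. j \<noteq> out \<longrightarrow> r2 j = r j" using r1(3) r2(3) by simp
    with runs_append[OF r1(1) r2(1)] r2(2)
    show "\<exists>r'. runs (q @ p) r r' \<and> r' out = y \<and> (\<forall>j<n. j \<noteq> out \<longrightarrow> r' j = r j)"
      by (intro exI[of _ r2] conjI)
  qed
  then show "\<exists>p. computes p (Comp f gs) rs out n" ..
qed

text \<open>Inverting \<open>prim_Suc\<close> exposes a value at the preceding argument. This
  supplies the intermediate values that the loop below goes through.\<close>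

lemma rec_eval_PrimRec_le:
  "rec_eval (PrimRec f g) ((a + b) # xs) y \<Longrightarrow> \<exists>z. rec_eval (PrimRec f g) (a # xs) z"
proof (induction b arbitrary: y)
  case (Suc b)
  then show ?case by (auto elim!: rec_eval_elims(6))
qed auto

text \<open>Register \<open>n\<close> counts up, \<open>Suc n\<close> holds the value at that count
  (the loop invariant), \<open>n + 2\<close> receives the result of \<open>g\<close>, and
  \<open>n + 3\<close> counts the remaining rounds down.\<close>

lemma runs_PrimRec_loop:
  assumes g: "computes p g (n # Suc n # rs) (n + 2) (n + 4)" and rs: "set rs \<subseteq> {..<n}"
  assumes "rec_eval (PrimRec f g) ((i + m) # map r rs) y"
    and "r n = i" and "r (n + 3) = m" and "rec_eval (PrimRec f g) (i # map r rs) (r (Suc n))"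
  shows "\<exists>r'. runs [While (n + 3) (p @ [Copy (Suc n) (n + 2), Incr n, Decr (n + 3)])] r r' \<and>
    r' (Suc n) = y \<and> (\<forall>j<n. r' j = r j)"
  using assms(3-)
proof (induction m arbitrary: i r)
  case 0
  then have "rec_eval (PrimRec f g) (i # map r rs) y" by simp
  with 0(4) have "r (Suc n) = y" by (rule rec_eval_deterministic)
  with runs_While_zero[of r "n + 3", OF 0(3)] show ?case by (intro exI[of _ r]) simp
next
  case (Suc m)
  obtain z where z: "rec_eval (PrimRec f g) (Suc i # map r rs) z"
    using rec_eval_PrimRec_le[of f g "Suc i" m] Suc.prems(1) by (metis add_Suc_shift)
  then obtain w where w: "rec_eval (PrimRec f g) (i # map r rs) w" "rec_eval g (i # w # map r rs) z"
    by (rule rec_eval_elims(6))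
  have "w = r (Suc n)" using w(1) Suc.prems(4) by (rule rec_eval_deterministic)
  with w(2) Suc.prems(2) have "rec_eval g (map r (n # Suc n # rs)) z" by simp
  then obtain r1 where r1: "runs p r r1" "r1 (n + 2) = z"
      "\<forall>j<n + 4. j \<noteq> n + 2 \<longrightarrow> r1 j = r j"
    by (rule computesE[OF g])
  define r2 where "r2 = r1(Suc n := z, n := Suc i, n + 3 := m)"
  have "runs [Copy (Suc n) (n + 2), Incr n, Decr (n + 3)] r1 r2"
    using r1 Suc.prems by (auto simp: r2_def simp: runs_basic runs_Nil_iff)
  with r1(1) have body: "runs (p @ [Copy (Suc n) (n + 2), Incr n, Decr (n + 3)]) r r2"
    by (rule runs_append)
  have same: "\<forall>j<n. r2 j = r j" using r1(3) by (auto simp: r2_def)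
  then have eq: "map r2 rs = map r rs" using rs by (auto simp: subset_eq)
  have "r2 n = Suc i" "r2 (n + 3) = m" "r2 (Suc n) = z" by (auto simp: r2_def)
  moreover from Suc.prems(1) have "rec_eval (PrimRec f g) ((Suc i + m) # map r2 rs) y"
    unfolding eq by simp
  moreover from z have "rec_eval (PrimRec f g) (Suc i # map r2 rs) z" unfolding eq .
  ultimately obtain r'
    where "runs [While (n + 3) (p @ [Copy (Suc n) (n + 2), Incr n, Decr (n + 3)])] r2 r'"
      "r' (Suc n) = y" "\<forall>j<n. r' j = r2 j"
    using Suc.IH[of "Suc i" r2] by blast
  moreover have "r (n + 3) \<noteq> 0" using Suc.prems(3) by simp
  ultimately show ?case using same by (intro exI[of _ r'] conjI runs_While_pos[of r "n + 3", OF _ body]) auto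
qed

lemma implementable_PrimRec:
  assumes f: "implementable f" and g: "implementable g"
  shows "implementable (PrimRec f g)"
  unfolding implementable_def
proof (intro allI impI)
  fix rs :: "nat list" and out n :: nat
  assume rs: "set rs \<subseteq> {..<n}" and out: "out < n" "out \<notin> set rs"
  show "\<exists>p. computes p (PrimRec f g) rs out n"
  proof (cases rs)
    case Nil
    \<comment> \<open>Without a recursion argument no value is derivable, so every program
      qualifies.\<close>
    then show ?thesis
      by (auto simp: computes_def elim: rec_eval.cases)
  next
    case (Cons a rs')
    have rs': "set rs' \<subseteq> {..<n}" "a < n" using rs Cons by auto
    have "set rs' \<subseteq> {..<n + 4}" "Suc n < n + 4" "Suc n \<notin> set rs'"
      using rs' by auto
    then obtain p where p: "computes p f rs' (Suc n) (n + 4)"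
      by (rule implementableE[OF f])
    have "set (n # Suc n # rs') \<subseteq> {..<n + 4}" "n + 2 < n + 4" "n + 2 \<notin> set (n # Suc n # rs')"
      using rs' by auto
    then obtain q where q: "computes q g (n # Suc n # rs') (n + 2) (n + 4)"
      by (rule implementableE[OF g])
    let ?loop = "[While (n + 3) (q @ [Copy (Suc n) (n + 2), Incr n, Decr (n + 3)])]"
    let ?init = "[Clear n, Copy (n + 3) a]"
    have "computes (p @ ?init @ ?loop @ [Copy out (Suc n)]) (PrimRec f g) rs out n"
      unfolding computes_def
    proof (intro allI impI)
      fix r y assume "rec_eval (PrimRec f g) (map r rs) y"
      then have y: "rec_eval (PrimRec f g) (r a # map r rs') y" by (simp add: Cons)
      obtain z where z: "rec_eval (PrimRec f g) (0 # map r rs') z"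
        using rec_eval_PrimRec_le[of f g 0 "r a"] y by auto
      then have "rec_eval f (map r rs') z" by (rule rec_eval_elims(5))
      then obtain r1 where r1: "runs p r r1" "r1 (Suc n) = z"
          "\<forall>j<n + 4. j \<noteq> Suc n \<longrightarrow> r1 j = r j"
        by (rule computesE[OF p])
      define r2 where "r2 = r1(n := 0, n + 3 := r a)"
      have init: "runs ?init r1 r2"
        using r1 rs'(2) by (auto simp: r2_def simp: runs_basic runs_Nil_iff)
      have same: "\<forall>j<n. r2 j = r j" using r1(3) by (auto simp: r2_def)
      then have eq: "map r2 rs' = map r rs'" using rs' by (auto simp: subset_eq)
      have "r2 n = 0" "r2 (n + 3) = r a" "r2 (Suc n) = z" using r1(2) by (auto simp: r2_def)
      moreover from y have "rec_eval (PrimRec f g) ((0 + r a) # map r2 rs') y"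
        unfolding eq by simp
      moreover from z have "rec_eval (PrimRec f g) (0 # map r2 rs') z" unfolding eq .
      ultimately obtain r3 where r3: "runs ?loop r2 r3" "r3 (Suc n) = y" "\<forall>j<n. r3 j = r2 j"
        using runs_PrimRec_loop[OF q rs'(1), of f 0 "r a" r2 y] by blast
      have "runs [Copy out (Suc n)] r3 (r3(out := y))"
        using r3(2) by (auto simp: runs_basic runs_Nil_iff)
      then have "runs (p @ ?init @ ?loop @ [Copy out (Suc n)]) r (r3(out := y))"
        by (rule runs_append[OF r1(1) runs_append[OF init runs_append[OF r3(1)]]])
      then show "\<exists>r'. runs (p @ ?init @ ?loop @ [Copy out (Suc n)]) r r' \<and> r' out = y \<and>
          (\<forall>j<n. j \<noteq> out \<longrightarrow> r' j = r j)"
        using r3(3) same by (intro exI[of _ "r3(out := y)"]) auto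
    qed
    then show ?thesis ..
  qed
qed

text \<open>Register \<open>n\<close> is the current candidate and \<open>Suc n\<close> holds the
  value of \<open>f\<close> there, which is nonzero until the least zero \<open>i + m\<close> is
  reached.\<close>

lemma runs_Mu_loop:
  assumes p: "computes p f (n # rs) (Suc n) (n + 2)" and rs: "set rs \<subseteq> {..<n}"
  assumes "rec_eval f ((i + m) # map r rs) 0"
    and "\<forall>j<i + m. \<exists>y. rec_eval f (j # map r rs) (Suc y)"
    and "r n = i" and "rec_eval f (i # map r rs) (r (Suc n))"
  shows "\<exists>r'. runs [While (Suc n) (Incr n # p)] r r' \<and> r' n = i + m \<and> (\<forall>j<n. r' j = r j)"
  using assms(3-)
proof (induction m arbitrary: i r)
  case 0
  then have "rec_eval f (i # map r rs) 0" by simp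
  with 0(4) have "r (Suc n) = 0" by (rule rec_eval_deterministic)
  with 0(3) show ?case by (intro exI[of _ r]) (simp add: runs_While_zero)
next
  case (Suc m)
  have "\<exists>y. rec_eval f (Suc i # map r rs) y"
  \<comment> \<open>\<open>Suc i\<close> is either the zero itself or still below it;
    \<open>f\<close> is defined in both cases.\<close>
  proof (cases m)
    case 0
    with Suc.prems(1) show ?thesis by auto
  next
    case (Suc k)
    with Suc.prems(2) have "\<exists>y. rec_eval f (Suc i # map r rs) (Suc y)"
      by (elim allE[of _ "Suc i"]) simp
    then show ?thesis by blast
  qed
  then obtain y where y: "rec_eval f (Suc i # map r rs) y" by blast
  obtain w where "rec_eval f (i # map r rs) (Suc w)" using Suc.prems(2) by force
  from rec_eval_deterministic[OF this Suc.prems(4)] have nz: "r (Suc n) \<noteq> 0" by simp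
  define r1 where "r1 = r(n := Suc i)"
  have eq1: "map r1 rs = map r rs" using rs by (auto simp: r1_def)
  have "rec_eval f (map r1 (n # rs)) y" unfolding list.map(2) eq1 using y by (simp add: r1_def)
  then obtain r2 where r2: "runs p r1 r2" "r2 (Suc n) = y"
      "\<forall>j<n + 2. j \<noteq> Suc n \<longrightarrow> r2 j = r1 j"
    by (rule computesE[OF p])
  have body: "runs (Incr n # p) r r2"
    using r2(1) Suc.prems(3) by (auto simp: r1_def simp: runs_basic)
  have same: "\<forall>j<n. r2 j = r j" using r2(3) by (auto simp: r1_def)
  then have eq: "map r2 rs = map r rs" using rs by (auto simp: subset_eq)
  have "r2 n = Suc i" using r2(3) by (simp add: r1_def)
  moreover from Suc.prems(1) have "rec_eval f ((Suc i + m) # map r2 rs) 0" unfolding eq by simp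
  moreover from Suc.prems(2) have "\<forall>j<Suc i + m. \<exists>y. rec_eval f (j # map r2 rs) (Suc y)"
    unfolding eq by simp
  moreover from y have "rec_eval f (Suc i # map r2 rs) (r2 (Suc n))" unfolding eq r2(2) .
  ultimately obtain r' where "runs [While (Suc n) (Incr n # p)] r2 r'" "r' n = Suc i + m"
      "\<forall>j<n. r' j = r2 j"
    using Suc.IH[of "Suc i" r2] by blast
  then show ?case
    using same by (intro exI[of _ r'] conjI runs_While_pos[of r "Suc n", OF nz body]) auto
qed

lemma implementable_Mu:
  assumes f: "implementable f"
  shows "implementable (Mu f)"
  unfolding implementable_def
proof (intro allI impI)
  fix rs :: "nat list" and out n :: nat
  assume rs: "set rs \<subseteq> {..<n}" and out: "out < n" "out \<notin> set rs"
  have "set (n # rs) \<subseteq> {..<n + 2}" "Suc n < n + 2" "Suc n \<notin> set (n # rs)"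
    using rs by auto
  then obtain p where p: "computes p f (n # rs) (Suc n) (n + 2)"
    by (rule implementableE[OF f])
  let ?loop = "[While (Suc n) (Incr n # p)]"
  have "computes ((Clear n # p) @ ?loop @ [Copy out n]) (Mu f) rs out n"
    unfolding computes_def
  proof (intro allI impI)
    fix r y assume "rec_eval (Mu f) (map r rs) y"
    then have y: "rec_eval f (y # map r rs) 0"
      and below: "\<forall>m<y. \<exists>z. rec_eval f (m # map r rs) (Suc z)"
      by (rule rec_eval_elims(7), blast)+
    have "\<exists>z. rec_eval f (0 # map r rs) z" using y below by (cases y) auto
    then obtain z where z: "rec_eval f (0 # map r rs) z" by blast
    define r1 where "r1 = r(n := 0)"
    have eq: "map r1 rs = map r rs" using rs by (auto simp: r1_def)
    have "rec_eval f (map r1 (n # rs)) z" unfolding list.map(2) eq using z by (simp add: r1_def)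
    then obtain r2 where r2: "runs p r1 r2" "r2 (Suc n) = z"
        "\<forall>j<n + 2. j \<noteq> Suc n \<longrightarrow> r2 j = r1 j"
      by (rule computesE[OF p])
    have init: "runs (Clear n # p) r r2"
      using r2(1) by (auto simp: r1_def simp: runs_basic)
    have same: "\<forall>j<n. r2 j = r j" using r2(3) by (auto simp: r1_def)
    then have eq: "map r2 rs = map r rs" using rs by (auto simp: subset_eq)
    have "r2 n = 0" using r2(3) by (simp add: r1_def)
    moreover from y have "rec_eval f ((0 + y) # map r2 rs) 0" unfolding eq by simp
    moreover from below have "\<forall>j<0 + y. \<exists>z. rec_eval f (j # map r2 rs) (Suc z)"
      unfolding eq by simp
    moreover from z have "rec_eval f (0 # map r2 rs) (r2 (Suc n))" unfolding eq r2(2) .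
    ultimately obtain r3 where r3: "runs ?loop r2 r3" "r3 n = 0 + y" "\<forall>j<n. r3 j = r2 j"
      using runs_Mu_loop[OF p rs, of 0 y r2] by blast
    have "runs [Copy out n] r3 (r3(out := y))"
      using r3(2) by (auto simp: runs_basic runs_Nil_iff)
    then have "runs ((Clear n # p) @ ?loop @ [Copy out n]) r (r3(out := y))"
      by (rule runs_append[OF init runs_append[OF r3(1)]])
    then show "\<exists>r'. runs ((Clear n # p) @ ?loop @ [Copy out n]) r r' \<and> r' out = y \<and>
        (\<forall>j<n. j \<noteq> out \<longrightarrow> r' j = r j)"
      using r3(3) same by (intro exI[of _ "r3(out := y)"]) auto
  qed
  then show "\<exists>p. computes p (Mu f) rs out n" ..
qed

lemma all_implementable: "implementable f"
  by (induction f) (simp_all add: implementable_Zero implementable_Succ implementable_Proj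
    implementable_Comp implementable_PrimRec implementable_Mu)

section \<open>Computable functions\<close>

definition computable :: "nat \<Rightarrow> (nat list \<Rightarrow> nat) \<Rightarrow> bool" where
  "computable k f \<longleftrightarrow> (\<exists>e. \<forall>xs. length xs = k \<longrightarrow> rec_eval e xs (f xs))"

abbreviation computable1 :: "(nat \<Rightarrow> nat) \<Rightarrow> bool" where
  "computable1 f \<equiv> computable 1 (\<lambda>xs. f (xs ! 0))"

abbreviation computable2 :: "(nat \<Rightarrow> nat \<Rightarrow> nat) \<Rightarrow> bool" where
  "computable2 f \<equiv> computable 2 (\<lambda>xs. f (xs ! 0) (xs ! 1))"

lemma computable_proj: "i < k \<Longrightarrow> computable k (\<lambda>xs. xs ! i)"
  unfolding computable_def by (blast intro: rec_eval.proj)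

lemma computable_comp1:
  assumes "computable1 f" and "computable k g"
  shows "computable k (\<lambda>xs. f (g xs))"
proof -
  obtain d where d: "\<And>xs. length xs = 1 \<Longrightarrow> rec_eval d xs (f (xs ! 0))"
    using assms(1) unfolding computable_def by blast
  obtain e where e: "\<And>xs. length xs = k \<Longrightarrow> rec_eval e xs (g xs)"
    using assms(2) unfolding computable_def by blast
  have "rec_eval (Comp d [e]) xs (f (g xs))" if "length xs = k" for xs
    by (rule rec_eval.comp[of _ _ "[g xs]"]) (use e[OF that] d[of "[g xs]"] in auto)
  then show ?thesis unfolding computable_def by blast
qed

lemma computable_comp2:
  assumes "computable2 f" and "computable k g" and "computable k h"
  shows "computable k (\<lambda>xs. f (g xs) (h xs))"
proof -
  obtain d where d: "\<And>xs. length xs = 2 \<Longrightarrow> rec_eval d xs (f (xs ! 0) (xs ! 1))"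
    using assms(1) unfolding computable_def by blast
  obtain e where e: "\<And>xs. length xs = k \<Longrightarrow> rec_eval e xs (g xs)"
    using assms(2) unfolding computable_def by blast
  obtain e' where e': "\<And>xs. length xs = k \<Longrightarrow> rec_eval e' xs (h xs)"
    using assms(3) unfolding computable_def by blast
  have "rec_eval (Comp d [e, e']) xs (f (g xs) (h xs))" if "length xs = k" for xs
    by (rule rec_eval.comp[of _ _ "[g xs, h xs]"])
      (use e[OF that] e'[OF that] d[of "[g xs, h xs]"] in auto)
  then show ?thesis unfolding computable_def by blast
qed

lemma computable_Suc:
  assumes "computable k f"
  shows "computable k (\<lambda>xs. Suc (f xs))"
proof (rule computable_comp1[OF _ assms])
  have "rec_eval Succ xs (Suc (xs ! 0))" if "length xs = 1" for xs
    using that by (cases xs) (auto intro: rec_eval.succ)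
  then show "computable1 Suc" unfolding computable_def by blast
qed

lemma computable_const: "computable k (\<lambda>xs. c)"
proof (induction c)
  case 0
  show ?case unfolding computable_def by (blast intro: rec_eval.zero)
qed (rule computable_Suc)

lemma computable_add:
  assumes "computable k f" and "computable k g"
  shows "computable k (\<lambda>xs. f xs + g xs)"
proof (rule computable_comp2[OF _ assms])
  let ?e = "PrimRec (Proj 0) (Comp Succ [Proj 1])"
  have "rec_eval ?e [a, b] (a + b)" for a b
  proof (induction a)
    case 0
    show ?case using rec_eval.proj[of 0 "[b]"] by (auto intro: rec_eval.prim_0)
  next
    case (Suc a)
    have "rec_eval (Comp Succ [Proj 1]) [a, a + b, b] (Suc (a + b))"
      by (rule rec_eval.comp[of _ _ "[a + b]"])
        (use rec_eval.proj[of 1 "[a, a + b, b]"] in \<open>auto intro: rec_eval.succ\<close>)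
    with Suc show ?case by (auto intro: rec_eval.prim_Suc)
  qed
  then have "rec_eval ?e xs (xs ! 0 + xs ! 1)" if "length xs = 2" for xs
    using that by (auto simp: numeral_2_eq_2 length_Suc_conv)
  then show "computable2 (+)" unfolding computable_def by blast
qed

lemma computable_rec:
  assumes g: "computable2 g" and Suc: "\<And>n. f (Suc n) = g n (f n)"
  shows "computable1 f"
proof -
  obtain d where d: "\<And>xs. length xs = 0 \<Longrightarrow> rec_eval d xs (f 0)"
    using computable_const[of 0 "f 0"] unfolding computable_def by blast
  obtain e where e: "\<And>xs. length xs = 2 \<Longrightarrow> rec_eval e xs (g (xs ! 0) (xs ! 1))"
    using g unfolding computable_def by blast
  have rec: "rec_eval (PrimRec d e) [n] (f n)" for n
  proof (induction n)
    case 0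
    show ?case using d by (auto intro: rec_eval.prim_0)
  next
    case (Suc n)
    then show ?case using e[of "[n, f n]"] assms(2)[of n] by (auto intro: rec_eval.prim_Suc)
  qed
  have "rec_eval (PrimRec d e) xs (f (xs ! 0))" if "length xs = 1" for xs
    using rec[of "hd xs"] that by (cases xs) auto
  then show ?thesis unfolding computable_def by blast
qed

lemma computable_power2:
  assumes "computable k f"
  shows "computable k (\<lambda>xs. 2 ^ f xs)"
proof (rule computable_comp1[OF _ assms])
  have "computable2 (\<lambda>n y. y + y)"
    by (intro computable_add computable_proj) simp_all
  then show "computable1 ((^) 2)" by (rule computable_rec) simp
qed

text \<open>\<open>prod_encode (m, n)\<close> is \<open>triangle (m + n) + m\<close>, and
  \<open>triangle\<close> satisfies a primitive recursion.\<close>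

lemma computable_prod_encode:
  assumes "computable k f" and "computable k g"
  shows "computable k (\<lambda>xs. prod_encode (f xs, g xs))"
proof -
  have "computable2 (\<lambda>n y. y + Suc n)"
    by (intro computable_add computable_Suc computable_proj) simp_all
  then have "computable1 triangle" by (rule computable_rec) simp
  from computable_comp1[OF this computable_add[OF assms]] show ?thesis
    unfolding prod_encode_def prod.case by (rule computable_add[OF _ assms(1)])
qed

text \<open>By injectivity each new element sets a fresh bit, so the mask grows by adding a power of
  two.\<close>

lemma computable_set_encode_image:
  assumes h: "computable1 h" and "inj h" and f: "computable k f"
  shows "computable k (\<lambda>xs. set_encode (h ` {..<f xs}))"
proof -
  have "computable1 (\<lambda>n. set_encode (h ` {..<n}))"
  proof (rule computable_rec)
    show "computable2 (\<lambda>n y. 2 ^ h n + y)"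
      by (intro computable_add computable_power2 computable_comp1[OF h] computable_proj) simp_all
    show "set_encode (h ` {..<Suc n}) = 2 ^ h n + set_encode (h ` {..<n})" for n
      using \<open>inj h\<close> by (simp add: lessThan_Suc inj_image_mem_iff)
  qed
  from computable_comp1[OF this f] show ?thesis .
qed

section \<open>A non-recognizable language\<close>

text \<open>Compactness by diagonalisation: since there are finitely many states, subsequences can
  be chosen that fix the state at one position after the other. Each tile condition involves only
  four positions and hence passes to the limit.\<close>

lemma is_run_limit:
  fixes p :: "nat \<Rightarrow> 'a picture" and \<rho> :: "nat \<Rightarrow> nat \<times> nat \<Rightarrow> 'q"
  assumes fin: "finite (states A)" and run: "\<And>n. is_run A (p n) (\<rho> n)"
    and lim: "\<And>u. \<forall>\<^sub>F n in sequentially. p n u = p' u"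
  obtains s \<rho>' where "strict_mono (s :: nat \<Rightarrow> nat)" and "is_run A p' \<rho>'"
    and "\<And>u. \<forall>\<^sub>F n in sequentially. \<rho> (s n) u = \<rho>' u"
proof -
  define P where "P n s \<longleftrightarrow> (\<exists>q. \<forall>k. \<rho> (s k) (prod_decode n) = q)" for n and s :: "nat \<Rightarrow> nat"
  have in_states: "\<rho> n u \<in> states A" for n u
    using run[of n] unfolding is_run_def by auto
  interpret subseqs P
  proof
    fix n :: nat and s :: "nat \<Rightarrow> nat"
    have "finite (range (\<lambda>k. \<rho> (s k) (prod_decode n)))"
      by (rule finite_subset[OF _ fin]) (use in_states in blast)
    from pigeonhole_infinite[OF infinite_UNIV_nat this]
    obtain k where k: "infinite {l \<in> UNIV. \<rho> (s l) (prod_decode n) = \<rho> (s k) (prod_decode n)}"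
      (is "infinite ?S") by blast
    have "P n (s \<circ> enumerate ?S)"
      using enumerate_in_set[OF k] by (auto simp: P_def)
    then show "\<exists>r. strict_mono r \<and> P n (s \<circ> r)"
      using strict_mono_enumerate[OF k] by blast
  qed
  have "\<exists>q. \<forall>\<^sub>F k in sequentially. \<rho> (diagseq k) u = q" for u
  proof -
    \<comment> \<open>The diagonal sequence is a subsequence of the \<open>n\<close>-th refinement
      only from index \<open>Suc n\<close> on, hence the shift.\<close>
    have "P (prod_encode u) (diagseq \<circ> (+) (Suc (prod_encode u)))"
      by (rule diagseq_holds) (auto simp: P_def)
    then obtain q where q: "\<And>k. \<rho> (diagseq (Suc (prod_encode u) + k)) u = q"
      by (auto simp: P_def)
    have "\<rho> (diagseq k) u = q" if "k \<ge> Suc (prod_encode u)" for k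
      using q[of "k - Suc (prod_encode u)"] that by simp
    then show ?thesis unfolding eventually_sequentially by blast
  qed
  then have "\<exists>\<rho>'. \<forall>u. \<forall>\<^sub>F k in sequentially. \<rho> (diagseq k) u = \<rho>' u"
    by (intro choice allI)
  then obtain \<rho>' where \<rho>': "\<And>u. \<forall>\<^sub>F k in sequentially. \<rho> (diagseq k) u = \<rho>' u"
    by blast
  have lim': "\<forall>\<^sub>F k in sequentially. p (diagseq k) u = p' u \<and> \<rho> (diagseq k) u = \<rho>' u" for u
    using eventually_subseq[OF subseq_diagseq lim[of u]] \<rho>'[of u] by (rule eventually_conj)
  have "is_run A p' \<rho>'"
    unfolding is_run_def
  proof (intro conjI allI subsetI)
    fix q assume "q \<in> range \<rho>'"
    then obtain u where u: "q = \<rho>' u" by blast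
    obtain k where "\<rho> (diagseq k) u = \<rho>' u" using eventually_happens[OF lim'[of u]] by auto
    with in_states[of "diagseq k" u] u show "q \<in> states A" by simp
  next
    fix i j
    from lim'[of "(i, j)"] lim'[of "(i + 1, j)"] lim'[of "(i, j + 1)"] lim'[of "(i + 1, j + 1)"]
    have "\<forall>\<^sub>F k in sequentially. ((p' (i, j + 1), \<rho>' (i, j + 1)), (p' (i + 1, j + 1), \<rho>' (i + 1, j + 1)),
        (p' (i, j), \<rho>' (i, j)), (p' (i + 1, j), \<rho>' (i + 1, j))) \<in> tiles A"
    proof eventually_elim
      case (elim k)
      from run[of "diagseq k"]
      have "((p (diagseq k) (i, j + 1), \<rho> (diagseq k) (i, j + 1)),
          (p (diagseq k) (i + 1, j + 1), \<rho> (diagseq k) (i + 1, j + 1)),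
          (p (diagseq k) (i, j), \<rho> (diagseq k) (i, j)),
          (p (diagseq k) (i + 1, j), \<rho> (diagseq k) (i + 1, j))) \<in> tiles A"
        unfolding is_run_def by blast
      then show ?case unfolding elim[THEN conjunct1] elim[THEN conjunct2] .
    qed
    then show "((p' (i, j + 1), \<rho>' (i, j + 1)), (p' (i + 1, j + 1), \<rho>' (i + 1, j + 1)),
        (p' (i, j), \<rho>' (i, j)), (p' (i + 1, j), \<rho>' (i + 1, j))) \<in> tiles A"
      by simp
  qed
  from that[OF subseq_diagseq this \<rho>'] show thesis .
qed

text \<open>Row 1 carries the letter 0 throughout, hence the positions 0 and 1 of \<open>x\<close> are ignored.\<close>

definition column_picture :: "(nat \<Rightarrow> bool) \<Rightarrow> nat picture" where
  "column_picture x = (\<lambda>(i, j). if i = 0 \<or> j = 0 then None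
     else Some (of_bool (i = 1 \<and> j \<ge> 2 \<and> x j)))"

lemma column_picture_omega_pictures: "{0, 1} \<subseteq> \<Sigma> \<Longrightarrow> column_picture x \<in> omega_pictures \<Sigma>"
  by (auto simp: column_picture_def omega_pictures_def of_bool_def)

text \<open>For a fixed position \<open>v\<close>, the sequences accepted there form a closed subset
  of Cantor space. Read contrapositively, a rejected sequence has a prefix all of whose extensions
  are rejected at \<open>v\<close>.\<close>

lemma run_on_column_picture_closed:
  assumes fin: "finite (states A)"
    and acc: "\<And>n. \<exists>y \<rho>. (\<forall>j<n. y j = x j) \<and> is_run A (column_picture y) \<rho> \<and> \<rho> v \<in> F"
  shows "\<exists>\<rho>. is_run A (column_picture x) \<rho> \<and> \<rho> v \<in> F"
proof -
  obtain y \<rho> where y: "\<And>n j. j < n \<Longrightarrow> y n j = x j"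
    and run: "\<And>n. is_run A (column_picture (y n)) (\<rho> n)" and F: "\<And>n. \<rho> n v \<in> F"
    using acc by metis
  \<comment> \<open>The letter at \<open>u\<close> depends on at most the entry \<open>snd u\<close>
    of the sequence, which is fixed as soon as \<open>n\<close> exceeds
    \<open>snd u\<close>.\<close>
  have lim: "\<forall>\<^sub>F n in sequentially. column_picture (y n) u = column_picture x u" for u
    unfolding eventually_sequentially using y
    by (intro exI[of _ "Suc (snd u)"]) (auto simp: column_picture_def split: prod.split)
  obtain s \<rho>' where run': "is_run A (column_picture x) \<rho>'"
    and ev: "\<And>u. \<forall>\<^sub>F n in sequentially. \<rho> (s n) u = \<rho>' u"
    using is_run_limit[OF fin run lim] by blast
  from eventually_happens[OF ev[of v]] F have "\<rho>' v \<in> F" by auto metis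
  with run' show ?thesis by blast
qed

text \<open>
  E-recognized languages are countable unions of closed sets, whereas the sequences with
  infinitely many ones do not form such a union: a sequence escaping all the closed sets is built
  by extending, one closed set after the other, a prefix that already avoids it.
\<close>

lemma not_E_recognizable:
  assumes \<Sigma>: "{0, 1} \<subseteq> \<Sigma>" and L: "\<And>x. column_picture x \<in> L \<longleftrightarrow> infinite {j. x j}"
  shows "\<not> E_recognizable \<Sigma> L"
proof
  assume "E_recognizable \<Sigma> L"
  then obtain A :: "(nat, nat) tiling_system" and F where sys: "accepting_system (A, F)"
    and alph: "alphabet A = \<Sigma>" and LE: "L = E_language (A, F)"
    unfolding E_recognizable_def by blast
  have fin: "finite (states A)" using sys by (simp add: accepting_system_def tiling_system_def)
  define acc where "acc x v \<longleftrightarrow> (\<exists>\<rho>. is_run A (column_picture x) \<rho> \<and> \<rho> v \<in> F)" for x v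
  have acc: "(\<exists>v. acc x v) \<longleftrightarrow> infinite {j. x j}" for x
    unfolding L[symmetric] LE E_language_def acc_def
    using column_picture_omega_pictures[OF \<Sigma>] by (auto simp: alph)
  \<comment> \<open>A stage \<open>(x, n)\<close> is a sequence with a frozen prefix of length
    \<open>n\<close>. Stage \<open>k + 1\<close> keeps the prefix of stage \<open>k\<close>, adds a
    one beyond it, and freezes enough to prevent every extension from being accepted at position
    \<open>prod_decode k\<close>.\<close>
  define Q where "Q = (\<lambda>k (x, n) (x', n'). (\<forall>j<n. x' j = x j) \<and> n < n' \<and> (\<exists>j<n'. n \<le> j \<and> x' j) \<and>
    (\<forall>y. (\<forall>j<n'. y j = x' j) \<longrightarrow> \<not> acc y (prod_decode k)))"
  have "\<exists>f. \<forall>k. finite {j. fst (f k) j} \<and> Q k (f k) (f (Suc k))"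
  proof (rule dependent_nat_choice)
    show "\<exists>f :: (nat \<Rightarrow> bool) \<times> nat. finite {j. fst f j}" by (rule exI[of _ "(\<lambda>_. False, 0)"]) simp
  next
    fix f :: "(nat \<Rightarrow> bool) \<times> nat" and k
    assume "finite {j. fst f j}"
    moreover obtain x n where f: "f = (x, n)" by fastforce
    ultimately have finx: "finite {j. x j}" by simp
    \<comment> \<open>Having finitely many ones, \<open>x\<close> is accepted at no position;
      closedness turns this into a prefix length \<open>n'\<close>.\<close>
    with acc have "\<not> acc x (prod_decode k)" by blast
    then obtain n' where n': "\<And>y. \<forall>j<n'. y j = x j \<Longrightarrow> \<not> acc y (prod_decode k)"
      using run_on_column_picture_closed[OF fin, of x "prod_decode k" F] unfolding acc_def by blast
    \<comment> \<open>The new one is placed beyond both prefixes, so it affects neither.\<close>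
    define m where "m = max n n'"
    have "finite {j. (x(m := True)) j}"
      by (rule finite_subset[of _ "insert m {j. x j}"]) (use finx in auto)
    moreover have "Q k f (x(m := True), Suc m)"
      using n' by (auto simp: Q_def f m_def)
    ultimately show "\<exists>f'. finite {j. fst f' j} \<and> Q k f f'"
      by (intro exI[of _ "(x(m := True), Suc m)"]) simp
  qed
  then obtain f where f: "\<And>k. Q k (f k) (f (Suc k))" by blast
  define x where "x k = fst (f k)" for k
  define n where "n k = snd (f k)" for k
  have step: "\<And>j k. j < n k \<Longrightarrow> x (Suc k) j = x k j" and inc: "\<And>k. n k < n (Suc k)"
    and one: "\<And>k. \<exists>j<n (Suc k). n k \<le> j \<and> x (Suc k) j"
    and avoid: "\<And>k y. \<forall>j<n (Suc k). y j = x (Suc k) j \<Longrightarrow> \<not> acc y (prod_decode k)"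
    using f by (auto simp: Q_def x_def n_def split_beta)
  have mono: "strict_mono n" using inc by (simp add: strict_mono_Suc_iff)
  have agree: "x l j = x k j" if "k \<le> l" "j < n k" for k l j
    using that
  proof (induction l rule: dec_induct)
    case (step l)
    have "j < n l" using step.hyps step.prems mono by (meson less_le_trans strict_mono_less_eq)
    with step \<open>\<And>j k. j < n k \<Longrightarrow> x (Suc k) j = x k j\<close> show ?case by simp
  qed simp
  \<comment> \<open>The limit of the stages: as \<open>n\<close> is strictly increasing, entry
    \<open>j\<close> is frozen at stage \<open>Suc j\<close> at the latest.\<close>
  define y where "y j = x (Suc j) j" for j
  have y: "y j = x k j" if "j < n k" for j k
  proof (cases "Suc j \<le> k")
    case True
    have "j < n (Suc j)" using strict_mono_imp_increasing[OF mono, of "Suc j"] by simp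
    with True agree show ?thesis by (simp add: y_def)
  next
    case False
    with that agree show ?thesis by (simp add: y_def)
  qed
  have "\<exists>j\<ge>k. y j" for k
    using one[of k] y[of _ "Suc k"] strict_mono_imp_increasing[OF mono, of k] le_trans by blast
  then have "infinite {j. y j}" by (auto simp: infinite_nat_iff_unbounded_le)
  with acc obtain v where v: "acc y v" by blast
  have "\<not> acc y (prod_decode (prod_encode v))"
    by (rule avoid) (use y in blast)
  with v show False by simp
qed

text \<open>Keep only the states in \<open>F\<close> and the tiles over them. Runs of the restricted
  system are exactly the runs that stay in \<open>F\<close>, and they visit \<open>F\<close>
  trivially.\<close>

lemma A_recognizable_imp_E_recognizable:
  assumes "A_recognizable \<Sigma> L"
  shows "E_recognizable \<Sigma> L"
proof -
  obtain A :: "('a, nat) tiling_system" and F where sys: "accepting_system (A, F)"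
    and alph: "alphabet A = \<Sigma>" and L: "L = A_language (A, F)"
    using assms unfolding A_recognizable_def by blast
  let ?C = "bordered \<Sigma> \<times> F"
  define B where "B = \<lparr>states = F, alphabet = \<Sigma>, tiles = tiles A \<inter> (?C \<times> ?C \<times> ?C \<times> ?C)\<rparr>"
  have "accepting_system (B, F)"
    using sys alph by (auto simp: B_def accepting_system_def tiling_system_def intro: finite_subset)
  moreover have "L = E_language (B, F)"
  proof -
    have run: "is_run B p \<rho> \<longleftrightarrow> is_run A p \<rho> \<and> (\<forall>v. \<rho> v \<in> F)"
      if "p \<in> omega_pictures \<Sigma>" for p and \<rho> :: "nat \<times> nat \<Rightarrow> nat"
    proof -
      have "p (i, j) \<in> bordered \<Sigma>" for i j
        using that by (cases i; cases j) (auto simp: omega_pictures_def bordered_def)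
      moreover have "F \<subseteq> states A" using sys by (simp add: accepting_system_def)
      ultimately show ?thesis
        by (simp add: is_run_def B_def image_subset_iff subset_eq) blast
    qed
    have alphB: "alphabet B = \<Sigma>" by (simp add: B_def)
    have ex: "\<exists>v. \<rho> v \<in> F" if "is_run B p \<rho>" for p and \<rho> :: "nat \<times> nat \<Rightarrow> nat"
      using that by (auto simp: is_run_def B_def)
    show ?thesis
      unfolding L A_language_def E_language_def prod.case alph alphB
    proof (intro Collect_cong conj_cong refl)
      fix p :: "'a picture" assume p: "p \<in> omega_pictures \<Sigma>"
      show "(\<exists>\<rho>. is_run A p \<rho> \<and> (\<forall>v. \<rho> v \<in> F)) \<longleftrightarrow> (\<exists>\<rho>. is_run B p \<rho> \<and> (\<exists>v. \<rho> v \<in> F))"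
        unfolding run[OF p, symmetric] using ex by blast
    qed
  qed
  moreover have "alphabet B = \<Sigma>" by (simp add: B_def)
  ultimately show ?thesis unfolding E_recognizable_def by blast
qed

lemma A_recognizable_empty: "finite \<Sigma> \<Longrightarrow> A_recognizable \<Sigma> {}"
  unfolding A_recognizable_def
  by (rule exI[of _ "\<lparr>states = {}, alphabet = \<Sigma>, tiles = {}\<rparr>"])
    (auto simp: accepting_system_def tiling_system_def A_language_def is_run_def)

section \<open>Tiling systems that simulate counter programs\<close>

text \<open>The programs reachable by \<^const>\<open>step\<close> from \<open>p @ k\<close> until \<open>k\<close> is reached.\<close>

fun conts :: "program \<Rightarrow> program \<Rightarrow> program set" where
  "conts [] k = {k}"
| "conts (While i c # p) k = conts c (While i c # p @ k) \<union> conts p k"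
| "conts (a # p) k = insert (a # p @ k) (conts p k)"

lemma finite_conts: "finite (conts p k)"
  by (induction p k rule: conts.induct) auto

lemma end_in_conts: "k \<in> conts p k"
  by (induction p k rule: conts.induct) auto

lemma start_in_conts: "p @ k \<in> conts p k"
  by (induction p k rule: conts.induct) (auto simp: end_in_conts)

lemma step_in_conts: "q \<in> conts p k \<Longrightarrow> fst (step (q, r)) \<in> conts p k \<or> q = k"
proof (induction p k rule: conts.induct)
  case (2 i c p k)
  \<comment> \<open>The continuation of the loop body is the loop itself, which is therefore the
    exceptional case of the first induction hypothesis; its step enters the body again or goes on to
    \<open>p @ k\<close>.\<close>
  have "fst (step (While i c # p @ k, r)) \<in> conts (While i c # p) k"
    using start_in_conts[of c] start_in_conts[of p k] by auto
  with 2 show ?case by auto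
qed (use start_in_conts in force)+

fun head_regs :: "program \<Rightarrow> nat set" where
  "head_regs (Copy i j # p) = {i, j}"
| "head_regs (Incr i # p) = {i}"
| "head_regs (Decr i # p) = {i}"
| "head_regs (Clear i # p) = {i}"
| "head_regs (While i c # p) = {i}"
| "head_regs [] = {}"

text \<open>A step touches only registers named by the first instruction. Register 0 is always
  included, so that the start row displays the input.\<close>

definition regs :: "program \<Rightarrow> nat set" where
  "regs p = insert 0 (\<Union>k\<in>conts p []. head_regs k)"

lemma finite_regs: "finite (regs p)"
proof -
  have "finite (head_regs k)" for k by (cases k rule: head_regs.cases) auto
  then show ?thesis by (simp add: regs_def finite_conts)
qed

text \<open>
  A row of a simulating run writes each register in unary: the cell at position \<open>x\<close> holds
  the program and the set of the registers \<open>i\<close> with \<open>x < r i\<close>. The new cells then depend only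
  on neighbouring old ones.
\<close>

definition same_at :: "nat set \<Rightarrow> nat \<Rightarrow> config \<Rightarrow> nat \<Rightarrow> config \<Rightarrow> bool" where
  "same_at V x s y s' \<longleftrightarrow> fst s = fst s' \<and> (\<forall>i\<in>V. x < snd s i \<longleftrightarrow> y < snd s' i)"

text \<open>The only branching test asks whether a register is zero, which is visible at position
  0.\<close>

lemma step_fst_local:
  assumes "same_at V 0 s 0 s'" and "head_regs (fst s) \<subseteq> V"
  shows "fst (step s) = fst (step s')"
  using assms by (cases s; cases s'; cases "fst s" rule: head_regs.cases) (auto simp: same_at_def)

text \<open>Decrementing shifts the unary word to the left, so the new bit is the old right
  neighbour; incrementing would require the left neighbour.\<close>

lemma step_snd_local_right:
  assumes "same_at V x s y s'" and "same_at V (Suc x) s (Suc y) s'"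
    and "head_regs (fst s) \<subseteq> V" and "j \<in> V" and "\<And>p. fst s \<noteq> Incr j # p"
  shows "x < snd (step s) j \<longleftrightarrow> y < snd (step s') j"
  using assms by (cases s; cases s'; cases "fst s" rule: head_regs.cases) (auto simp: same_at_def)

text \<open>The mirror case: after an increment the new bit at \<open>Suc x\<close> is the old bit
  at \<open>x\<close>.\<close>

lemma step_snd_local_left:
  assumes "same_at V x s y s'" and "same_at V (Suc x) s (Suc y) s'"
    and "head_regs (fst s) \<subseteq> V" and "j \<in> V" and "\<And>p. fst s \<noteq> Decr j # p"
  shows "Suc x < snd (step s) j \<longleftrightarrow> Suc y < snd (step s') j"
  using assms by (cases s; cases s'; cases "fst s" rule: head_regs.cases) (auto simp: same_at_def)

text \<open>At the left end an increment sets the bit unconditionally, so no left neighbour is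
  consulted.\<close>

lemma step_snd_local_0:
  assumes "same_at V 0 s 0 s'"
    and "head_regs (fst s) \<subseteq> V" and "j \<in> V" and "\<And>p. fst s \<noteq> Decr j # p"
  shows "0 < snd (step s) j \<longleftrightarrow> 0 < snd (step s') j"
  using assms by (cases s; cases s'; cases "fst s" rule: head_regs.cases) (auto simp: same_at_def)

text \<open>
  The states 2 and 3 stand for the cells of the start configuration where register 0 exceeds
  the position and where it does not. The chain of the states \<open>1, \<dots>, c\<close> in row 0 puts \<open>c\<close>
  copies of 2 above it. Since the letters of a tile tell whether it touches the border, the
  numbers serving as states in row 0 and in column 0 may be reused elsewhere.
\<close>

definition chain_tile :: "nat \<Rightarrow> (nat, nat) tile" where
  "chain_tile i = ((Some 0, 2), (Some 0, 2), (None, i), (None, Suc i))"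

definition end_tile :: "nat \<Rightarrow> (nat, nat) tile" where
  "end_tile c = ((Some 0, 2), (Some 0, 3), (None, c), (None, 0))"

text \<open>The state set is determined by \<open>c\<close> alone, so it can be computed without
  decoding \<open>T\<close>. It contains the chain states and 0 to 3; when \<open>c\<close> is the
  code of \<open>T\<close>, it also contains all states occurring in \<open>T\<close>.\<close>

definition input_system :: "(nat, nat) tile set \<Rightarrow> nat \<Rightarrow> (nat, nat) tiling_system" where
  "input_system T c = \<lparr>states = {..<c + 4}, alphabet = {0, 1},
     tiles = T \<union> chain_tile ` {..<c} \<union> {end_tile c}\<rparr>"

text \<open>The values 2 and 3 are tied to the fixed tiles of the start row. The lower bound 2 keeps
  the cells of configurations apart from the accepting state 1.\<close>

locale simulation =
  fixes prog :: program and enc :: "program \<times> nat set \<Rightarrow> nat"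
  assumes inj_enc: "inj_on enc (conts prog [] \<times> Pow (regs prog))"
    and enc_start: "enc (prog, {0}) = 2" "enc (prog, {}) = 3"
    and enc_ge: "enc z \<ge> 2"
begin

definition cell :: "config \<Rightarrow> nat \<Rightarrow> nat" where
  "cell s x = enc (fst s, {i\<in>regs prog. x < snd s i})"

definition active :: "config \<Rightarrow> bool" where
  "active s \<longleftrightarrow> fst s \<in> conts prog [] \<and> fst s \<noteq> []"

text \<open>
  All windows that occur in two consecutive configurations. In column 0, the states \<open>b\<close> and
  \<open>b'\<close> copy the letters of column 1, so that the accepting state 1, up to its
  occurrence in the chain of row 0, marks the ones there.
\<close>

definition left_tiles :: "(nat, nat) tile set" where
  "left_tiles = {((None, b'), (Some b', cell (step s) 0), (None, b), (Some b, cell s 0)) |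
     b b' s. b \<le> 1 \<and> b' \<le> 1 \<and> active s}"

definition inner_tiles :: "(nat, nat) tile set" where
  "inner_tiles = {((Some b', cell (step s) x), (Some 0, cell (step s) (Suc x)),
     (Some b, cell s x), (Some 0, cell s (Suc x))) | b b' s x. b \<le> 1 \<and> b' \<le> 1 \<and> active s}"

text \<open>The first explicit tile starts the chain at the corner; the second fills the two bottom
  rows to the right of the input.\<close>

definition base_tiles :: "(nat, nat) tile set" where
  "base_tiles = {((None, 0), (Some 0, 2), (None, 0), (None, 1)),
     ((Some 0, 3), (Some 0, 3), (None, 0), (None, 0))} \<union> left_tiles \<union> inner_tiles"

lemma step_conts: "fst s \<in> conts prog [] \<Longrightarrow> fst (step s) \<in> conts prog []"
  using step_in_conts[of "fst s" prog "[]" "snd s"] by (cases s) auto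

lemma active_head_regs: "active s \<Longrightarrow> head_regs (fst s) \<subseteq> regs prog"
  by (auto simp: active_def regs_def)

lemma cell_eq_iff:
  assumes "fst s \<in> conts prog []" and "fst s' \<in> conts prog []"
  shows "cell s x = cell s' y \<longleftrightarrow> same_at (regs prog) x s y s'"
proof -
  have "cell s x = cell s' y \<longleftrightarrow>
      (fst s, {i\<in>regs prog. x < snd s i}) = (fst s', {i\<in>regs prog. y < snd s' i})"
    unfolding cell_def by (rule inj_on_eq_iff[OF inj_enc]) (use assms in auto)
  then show ?thesis by (auto simp: same_at_def)
qed

text \<open>The windows range over infinitely many configurations and positions, but their cells
  take values in the finite set \<open>Q\<close>.\<close>

lemma finite_base_tiles: "finite base_tiles"
proof -
  define Q where "Q = {..3} \<union> enc ` (conts prog [] \<times> Pow (regs prog))"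
  let ?C = "insert None (Some ` {..1}) \<times> Q"
  have cell: "cell s x \<in> Q" if "fst s \<in> conts prog []" for s x
    using that by (auto simp: cell_def Q_def)
  then have active: "cell s x \<in> Q" "cell (step s) x \<in> Q" if "active s" for s x
    using that step_conts unfolding active_def by blast+
  have bit: "b \<in> Q" if "b \<le> Suc 0" for b using that by (simp add: Q_def)
  have "left_tiles \<subseteq> ?C \<times> ?C \<times> ?C \<times> ?C" "inner_tiles \<subseteq> ?C \<times> ?C \<times> ?C \<times> ?C"
    unfolding left_tiles_def inner_tiles_def using active bit by auto
  moreover have "{0, 1, 2, 3} \<subseteq> Q" by (auto simp: Q_def)
  ultimately have "base_tiles \<subseteq> ?C \<times> ?C \<times> ?C \<times> ?C" by (auto simp: base_tiles_def)
  then show ?thesis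
    by (rule finite_subset) (simp add: Q_def finite_conts finite_regs)
qed

definition config :: "nat \<Rightarrow> nat \<Rightarrow> config" where
  "config c t = (step ^^ t) (prog, (\<lambda>_. 0)(0 := c))"

lemma config_Suc: "config c (Suc t) = step (config c t)"
  by (simp add: config_def)

lemma config_conts: "fst (config c t) \<in> conts prog []"
proof (induction t)
  case 0
  show ?case using start_in_conts[of prog "[]"] by (simp add: config_def)
qed (simp add: config_Suc step_conts)

lemma cell_config_0: "cell (config c 0) x = (if x < c then 2 else 3)"
proof -
  have "{i\<in>regs prog. x < ((\<lambda>_. 0)(0 := c)) i} = (if x < c then {0} else {})"
    by (auto simp: regs_def)
  then show ?thesis by (simp add: cell_def config_def enc_start)
qed

end

section \<open>Every run spells out the computation\<close>

context simulation
begin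

lemmas tile_defs = base_tiles_def left_tiles_def inner_tiles_def chain_tile_def end_tile_def

definition system_tiles :: "nat \<Rightarrow> (nat, nat) tile set" where
  "system_tiles c = base_tiles \<union> chain_tile ` {..<c} \<union> {end_tile c}"

text \<open>The border letters of a tile reveal which family it comes from. This lemma and the next
  three invert membership for the four border patterns.\<close>

lemma corner_tileD:
  "((None, q1), (Some a, q2), (None, q3), (None, q4)) \<in> system_tiles c \<Longrightarrow> q2 = 2 \<and> q4 = 1"
  by (auto simp: system_tiles_def tile_defs)

lemma bottom_tileD:
  "((Some a, q1), (Some b, q2), (None, q3), (None, q4)) \<in> system_tiles c \<Longrightarrow>
    (q1 = 3 \<and> q2 = 3 \<and> q3 = 0 \<and> q4 = 0) \<or> (q1 = 2 \<and> q2 = 2 \<and> q3 < c \<and> q4 = Suc q3) \<or>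
    (q1 = 2 \<and> q2 = 3 \<and> q3 = c \<and> q4 = 0)"
  by (auto simp: system_tiles_def tile_defs)

lemma left_tileD:
  "((None, q1), (Some a, q2), (None, q3), (Some b, q4)) \<in> system_tiles c \<Longrightarrow>
    \<exists>s. active s \<and> q3 = b \<and> q4 = cell s 0 \<and> q2 = cell (step s) 0"
  by (auto simp: system_tiles_def tile_defs)

lemma inner_tileD:
  "((Some a1, q1), (Some a2, q2), (Some a3, q3), (Some a4, q4)) \<in> system_tiles c \<Longrightarrow>
    \<exists>s y. active s \<and> q3 = cell s y \<and> q4 = cell s (Suc y) \<and>
      q1 = cell (step s) y \<and> q2 = cell (step s) (Suc y)"
  by (auto simp: system_tiles_def tile_defs)

context
  fixes c :: nat and p :: "nat picture" and \<rho> :: "nat \<times> nat \<Rightarrow> nat"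
  assumes c: "c > 0" and p: "p \<in> omega_pictures {0, 1}"
    and run: "is_run (input_system base_tiles c) p \<rho>"
begin

lemma border: "p (i, 0) = None" "p (0, i) = None"
  using p by (auto simp: omega_pictures_def)

lemma inner_letter:
  obtains a where "p (Suc i, Suc j) = Some a"
  using p zero_less_Suc unfolding omega_pictures_def by blast

lemma tile_in:
  "((p (i, Suc j), \<rho> (i, Suc j)), (p (Suc i, Suc j), \<rho> (Suc i, Suc j)),
    (p (i, j), \<rho> (i, j)), (p (Suc i, j), \<rho> (Suc i, j)))
   \<in> system_tiles c"
  using run by (simp add: is_run_def input_system_def system_tiles_def)

text \<open>The chain is forced from the corner on. Beyond its end, state 0 in row 0 would also fit
  \<open>chain_tile 0\<close>, but the cell 3 above it excludes this.\<close>

lemma bottom_rows: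
  "\<rho> (Suc i, 0) = (if i < c then Suc i else 0) \<and> \<rho> (Suc i, Suc 0) = (if i < c then 2 else 3)"
proof (induction i)
  case 0
  obtain a where a: "p (Suc 0, Suc 0) = Some a" by (rule inner_letter)
  from corner_tileD[OF tile_in[of 0 0, unfolded border a]] c show ?case by simp
next
  case (Suc i)
  obtain a where a: "p (Suc i, Suc 0) = Some a" by (rule inner_letter)
  obtain a' where a': "p (Suc (Suc i), Suc 0) = Some a'" by (rule inner_letter)
  from bottom_tileD[OF tile_in[of "Suc i" 0, unfolded border a a']] Suc
  show ?case by (auto split: if_splits)
qed

lemma left_tile:
  "\<exists>s. active s \<and> p (Suc 0, Suc t) = Some (\<rho> (0, Suc t)) \<and>
    \<rho> (Suc 0, Suc t) = cell s 0 \<and> \<rho> (Suc 0, Suc (Suc t)) = cell (step s) 0"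
proof -
  obtain a where a: "p (Suc 0, Suc t) = Some a" by (rule inner_letter)
  obtain a' where a': "p (Suc 0, Suc (Suc t)) = Some a'" by (rule inner_letter)
  from left_tileD[OF tile_in[of 0 "Suc t", unfolded border a a']] a show ?thesis by auto
qed

lemma inner_tile:
  "\<exists>s y. active s \<and> \<rho> (Suc x, Suc t) = cell s y \<and> \<rho> (Suc (Suc x), Suc t) = cell s (Suc y) \<and>
    \<rho> (Suc x, Suc (Suc t)) = cell (step s) y \<and>
    \<rho> (Suc (Suc x), Suc (Suc t)) = cell (step s) (Suc y)"
proof -
  obtain a1 where a1: "p (Suc x, Suc t) = Some a1" by (rule inner_letter)
  obtain a2 where a2: "p (Suc (Suc x), Suc t) = Some a2" by (rule inner_letter)
  obtain a3 where a3: "p (Suc x, Suc (Suc t)) = Some a3" by (rule inner_letter)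
  obtain a4 where a4: "p (Suc (Suc x), Suc (Suc t)) = Some a4" by (rule inner_letter)
  from inner_tileD[OF tile_in[of "Suc x" "Suc t", unfolded a1 a2 a3 a4]] show ?thesis .
qed

text \<open>
  The program of the next row is determined in column 0 and propagates to the right. A bit of
  the next row is determined by the window ending at its column, or, for a decremented register,
  by the one starting there.
\<close>

lemma next_row:
  assumes row: "\<And>x. \<rho> (Suc x, Suc t) = cell s x" and s: "fst s \<in> conts prog []"
  shows "fst s \<noteq> []" and "\<rho> (Suc x, Suc (Suc t)) = cell (step s) x"
proof -
  let ?V = "regs prog"
  obtain s0 where *: "active s0" "\<rho> (Suc 0, Suc t) = cell s0 0"
    and s0: "\<rho> (Suc 0, Suc (Suc t)) = cell (step s0) 0"
    using left_tile[of t] by blast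
  from *(2) have "cell s 0 = cell s0 0" using row[of 0] by simp
  with *(1) s have "same_at ?V 0 s 0 s0" by (simp add: cell_eq_iff active_def)
  note s0 = *(1) this s0
  from s0(1,2) show "fst s \<noteq> []" by (simp add: active_def same_at_def)
  with s have act: "active s" by (simp add: active_def)
  note V = active_head_regs[OF act]
  have inner: "\<exists>s' y. active s' \<and> same_at ?V x s y s' \<and> same_at ?V (Suc x) s (Suc y) s' \<and>
      \<rho> (Suc x, Suc (Suc t)) = cell (step s') y \<and>
      \<rho> (Suc (Suc x), Suc (Suc t)) = cell (step s') (Suc y)" for x
  proof -
    obtain s' y where *: "active s'" "\<rho> (Suc x, Suc t) = cell s' y"
      "\<rho> (Suc (Suc x), Suc t) = cell s' (Suc y)"
      "\<rho> (Suc x, Suc (Suc t)) = cell (step s') y"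
      "\<rho> (Suc (Suc x), Suc (Suc t)) = cell (step s') (Suc y)"
      using inner_tile[of x t] by blast
    then have "cell s x = cell s' y" "cell s (Suc x) = cell s' (Suc y)"
      using row[of x] row[of "Suc x"] by simp_all
    then have "same_at ?V x s y s'" "same_at ?V (Suc x) s (Suc y) s'"
      using * s by (simp_all add: cell_eq_iff active_def)
    with * show ?thesis by blast
  qed
  \<comment> \<open>Windows of the new row may stem from different configurations \<open>s'\<close>,
    so each cell is decoded on its own into a program and a set of registers.\<close>
  define k where "k x = fst (the_inv_into (conts prog [] \<times> Pow ?V) enc (\<rho> (Suc x, Suc (Suc t))))"
    for x
  define R where "R x = snd (the_inv_into (conts prog [] \<times> Pow ?V) enc (\<rho> (Suc x, Suc (Suc t))))"
    for x
  have dec: "k x = fst (step s')" "R x = {i\<in>?V. y < snd (step s') i}"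
    if "active s'" "\<rho> (Suc x, Suc (Suc t)) = cell (step s') y" for x s' y
  proof -
    have "(fst (step s'), {i\<in>?V. y < snd (step s') i}) \<in> conts prog [] \<times> Pow ?V"
      using that(1) step_conts by (auto simp: active_def)
    from the_inv_into_f_f[OF inj_enc this]
    show "k x = fst (step s')" "R x = {i\<in>?V. y < snd (step s') i}"
      by (simp_all add: k_def R_def that(2) cell_def)
  qed
  have k: "k x = fst (step s)" for x
  proof (induction x)
    case 0
    show ?case using dec(1)[OF s0(1)] s0(3) step_fst_local[OF s0(2) V] by simp
  next
    case (Suc x)
    obtain s' y where *: "active s'" "\<rho> (Suc x, Suc (Suc t)) = cell (step s') y"
      "\<rho> (Suc (Suc x), Suc (Suc t)) = cell (step s') (Suc y)"
      using inner[of x] by blast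
    show ?case using dec(1)[OF *(1,2)] dec(1)[OF *(1,3)] Suc by simp
  qed
  have R: "R x = {i\<in>?V. x < snd (step s) i}" for x
  proof -
    have "j \<in> R x \<longleftrightarrow> x < snd (step s) j" if j: "j \<in> ?V" for j
    proof (cases "\<exists>q. fst s = Decr j # q")
      case True
      obtain s' y where *: "active s'" "same_at ?V x s y s'" "same_at ?V (Suc x) s (Suc y) s'"
        "\<rho> (Suc x, Suc (Suc t)) = cell (step s') y"
        using inner[of x] by blast
      show ?thesis
        using step_snd_local_right[OF *(2,3) V j] True j by (auto simp: dec(2)[OF *(1,4)])
    next
      case False
      show ?thesis
      proof (cases x)
        case 0
        then have "\<rho> (Suc x, Suc (Suc t)) = cell (step s0) 0" using s0(3) by simp
        from dec(2)[OF s0(1) this] step_snd_local_0[OF s0(2) V j] False j 0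
        show ?thesis by auto
      next
        case (Suc x')
        obtain s' y where *: "active s'" "same_at ?V x' s y s'" "same_at ?V (Suc x') s (Suc y) s'"
          "\<rho> (Suc (Suc x'), Suc (Suc t)) = cell (step s') (Suc y)"
          using inner[of x'] by blast
        from dec(2)[OF *(1,4)] step_snd_local_left[OF *(2,3) V j] False j Suc
        show ?thesis by auto
      qed
    qed
    moreover have "R x \<subseteq> ?V"
    proof -
      obtain s' y where *: "active s'" "\<rho> (Suc x, Suc (Suc t)) = cell (step s') y"
        using inner[of x] by blast
      show ?thesis using dec(2)[OF *] by simp
    qed
    ultimately show ?thesis by blast
  qed
  obtain s' y where *: "active s'" "\<rho> (Suc x, Suc (Suc t)) = cell (step s') y"
    using inner[of x] by blast
  have "\<rho> (Suc x, Suc (Suc t)) = enc (k x, R x)"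
    using *(2) dec[OF *] by (simp add: cell_def)
  then show "\<rho> (Suc x, Suc (Suc t)) = cell (step s) x"
    by (simp add: k R cell_def)
qed

lemma run_config: "\<rho> (Suc x, Suc t) = cell (config c t) x"
proof (induction t arbitrary: x)
  case 0
  show ?case using bottom_rows[of x] by (simp add: cell_config_0)
next
  case (Suc t)
  show ?case unfolding config_Suc by (rule next_row(2)[OF Suc config_conts])
qed

text \<open>The windows have active configurations in their lower row only, so nothing can be placed
  above a halted one.\<close>

lemma run_not_halting: "fst (config c t) \<noteq> []"
  by (rule next_row(1)[OF run_config config_conts])

text \<open>State 1 cannot occur inside the picture, occurs in row 0 to the right of the corner only
  as the first link of the chain, and in column 0 above the corner copies a letter of column
  1.\<close>

lemma run_flag:
  assumes "\<rho> v = 1" and "p = column_picture x"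
  shows "v \<in> insert (1, 0) (Pair 0 ` ({0, 1} \<union> {j. x j}))"
proof (cases v)
  case (Pair i j)
  consider "i = 0" "j = 0" | t where "i = 0" "j = Suc t" | i' where "i = Suc i'" "j = 0"
    | i' t where "i = Suc i'" "j = Suc t"
    by (cases i; cases j) auto
  then show ?thesis
  proof cases
    case 1
    with Pair show ?thesis by simp
  next
    case 2
    from left_tile[of t] obtain s where "p (Suc 0, Suc t) = Some (\<rho> (0, Suc t))" by blast
    with 2 Pair assms have "column_picture x (Suc 0, Suc t) = Some 1" by simp
    then have "x (Suc t)" by (cases "x (Suc t)") (simp_all add: column_picture_def)
    with 2 Pair show ?thesis by simp
  next
    case 3
    with Pair assms(1) have "\<rho> (Suc i', 0) = 1" by simp
    with conjunct1[OF bottom_rows[of i']] have "i' = 0" by (cases "i' < c") simp_all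
    with 3 Pair show ?thesis by simp
  next
    case 4
    have "\<rho> (Suc i', Suc t) \<ge> 2" unfolding run_config cell_def by (rule enc_ge)
    with 4 Pair assms(1) show ?thesis by simp
  qed
qed

end

section \<open>Existence of runs and the accepted column pictures\<close>

lemma column_picture_run:
  assumes c: "c > 0" and "\<And>t. fst (config c t) \<noteq> []"
    and bound: "\<And>s y. active s \<Longrightarrow> cell s y < c + 4"
  obtains \<rho> where "is_run (input_system base_tiles c) (column_picture x) \<rho>"
    and "\<And>j. j \<ge> 2 \<Longrightarrow> x j \<Longrightarrow> \<rho> (0, j) = 1"
proof -
  have active: "active (config c t)" for t
    using assms(2) config_conts by (simp add: active_def)
  define b :: "nat \<Rightarrow> nat" where "b j = of_bool (j \<ge> 2 \<and> x j)" for j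
  have b: "b j \<le> 1" "b 0 = 0" "b 1 = 0" for j by (simp_all add: b_def)
  \<comment> \<open>Row \<open>j\<close> shows time \<open>j - 1\<close> and column \<open>i\<close>
    shows unary position \<open>i - 1\<close>; column 0 copies the letters of column 1.\<close>
  define \<rho> where "\<rho> = (\<lambda>(i, j). if i = 0 then b j else if j = 0 then (if i - 1 < c then i else 0)
    else cell (config c (j - 1)) (i - 1))"
  have \<rho>: "\<rho> (0, j) = b j" "\<rho> (Suc i, 0) = (if i < c then Suc i else 0)"
    "\<rho> (Suc i, Suc t) = cell (config c t) i" for i j t
    by (simp_all add: \<rho>_def)
  let ?p = "column_picture x"
  have p: "?p (i, 0) = None" "?p (0, j) = None" "?p (Suc 0, Suc t) = Some (b (Suc t))"
    "?p (Suc i, Suc 0) = Some 0" "?p (Suc (Suc i), Suc t) = Some 0" for i j t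
    by (simp_all add: column_picture_def b_def)
  have "\<rho> (i, j) < c + 4" for i j
  proof (cases i)
    case 0
    then show ?thesis using b(1)[of j] by (simp add: \<rho>(1))
  next
    case (Suc i')
    then show ?thesis by (cases j) (auto simp: \<rho>(2,3) bound active)
  qed
  moreover have "((?p (i, j + 1), \<rho> (i, j + 1)), (?p (i + 1, j + 1), \<rho> (i + 1, j + 1)),
      (?p (i, j), \<rho> (i, j)), (?p (i + 1, j), \<rho> (i + 1, j)))
    \<in> base_tiles \<union> chain_tile ` {..<c} \<union> {end_tile c}" for i j
  proof -
    consider "i = 0" "j = 0" | t where "i = 0" "j = Suc t" | i' where "i = Suc i'" "j = 0"
      | i' t where "i = Suc i'" "j = Suc t"
      by (cases i; cases j) auto
    then show ?thesis
    proof cases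
      case 1
      then show ?thesis using c by (simp add: \<rho> p b[simplified] cell_config_0 base_tiles_def)
    next
      case 2
      have "((None, b (Suc (Suc t))), (Some (b (Suc (Suc t))), cell (step (config c t)) 0),
          (None, b (Suc t)), (Some (b (Suc t)), cell (config c t) 0)) \<in> left_tiles"
        unfolding left_tiles_def using b(1) active by blast
      with 2 show ?thesis by (simp add: \<rho> p base_tiles_def flip: config_Suc)
    next
      case 3
      \<comment> \<open>Inside the chain, at its last link, or to the right of it.\<close>
      consider "i' < c" "Suc i' < c" | "i' < c" "Suc i' = c" | "i' \<ge> c" by linarith
      then show ?thesis
      proof cases
        case 1
        then have "chain_tile (Suc i') \<in> chain_tile ` {..<c}" by blast
        with 1 3 show ?thesis by (simp add: \<rho> p cell_config_0 chain_tile_def)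
      qed (use 3 in \<open>auto simp: \<rho> p cell_config_0 base_tiles_def end_tile_def\<close>)
    next
      case 4
      have p0: "\<exists>d\<le>1. ?p (Suc i', Suc t) = Some d" for t
        by (auto simp: column_picture_def)
      obtain d d' where d: "d \<le> 1" "d' \<le> 1" "?p (Suc i', Suc t) = Some d"
        "?p (Suc i', Suc (Suc t)) = Some d'"
        using p0[of t] p0[of "Suc t"] by blast
      have "((Some d', cell (step (config c t)) i'), (Some 0, cell (step (config c t)) (Suc i')),
          (Some d, cell (config c t) i'), (Some 0, cell (config c t) (Suc i'))) \<in> inner_tiles"
        unfolding inner_tiles_def using d(1,2) active by blast
      with 4 d show ?thesis by (simp add: \<rho> p base_tiles_def flip: config_Suc)
    qed
  qed
  ultimately have "is_run (input_system base_tiles c) ?p \<rho>"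
    by (auto simp: is_run_def input_system_def)
  then show thesis by (rule that) (simp add: \<rho>(1) b_def)
qed

lemma Buchi_language_halting:
  assumes "c > 0" and "fst (config c t) = []"
  shows "Buchi_language (input_system base_tiles c, {1}) = {}"
  using run_not_halting[OF assms(1)] assms(2)
  by (auto simp: Buchi_language_def input_system_def)

text \<open>By \<open>run_flag\<close> the accepting positions are ones of \<open>x\<close> up to
  finitely many exceptions, and \<open>column_picture_run\<close> provides a run that marks all ones
  from position 2 on.\<close>

lemma Buchi_language_diverging:
  assumes c: "c > 0" and div: "\<And>t. fst (config c t) \<noteq> []"
    and bound: "\<And>s y. active s \<Longrightarrow> cell s y < c + 4"
  shows "column_picture x \<in> Buchi_language (input_system base_tiles c, {1}) \<longleftrightarrow> infinite {j. x j}"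
proof -
  have p: "column_picture x \<in> omega_pictures {0, 1}"
    by (rule column_picture_omega_pictures) simp
  then have mem: "column_picture x \<in> Buchi_language (input_system base_tiles c, {1}) \<longleftrightarrow>
      (\<exists>\<rho>. is_run (input_system base_tiles c) (column_picture x) \<rho> \<and> infinite {v. \<rho> v \<in> {1}})"
    by (simp add: Buchi_language_def input_system_def)
  show ?thesis
    unfolding mem
  proof
    assume "\<exists>\<rho>. is_run (input_system base_tiles c) (column_picture x) \<rho> \<and> infinite {v. \<rho> v \<in> {1}}"
    then obtain \<rho> where run: "is_run (input_system base_tiles c) (column_picture x) \<rho>"
      and inf: "infinite {v. \<rho> v = 1}" by auto
    have "{v. \<rho> v = 1} \<subseteq> insert (1, 0) (Pair 0 ` ({0, 1} \<union> {j. x j}))"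
      using run_flag[OF c p run] by blast
    with inf show "infinite {j. x j}" by (meson finite_subset finite_insert finite_imageI finite_Un finite.emptyI)
  next
    assume inf: "infinite {j. x j}"
    obtain \<rho> where run: "is_run (input_system base_tiles c) (column_picture x) \<rho>"
      and flag: "\<And>j. j \<ge> 2 \<Longrightarrow> x j \<Longrightarrow> \<rho> (0, j) = 1"
      using column_picture_run[OF c div bound] by blast
    have "infinite ({j. x j} - {..<2})" using inf by simp
    then have "infinite (Pair (0::nat) ` ({j. x j} - {..<2}))"
      by (simp add: finite_image_iff inj_on_def)
    moreover have "Pair 0 ` ({j. x j} - {..<2}) \<subseteq> {v. \<rho> v \<in> {1}}" using flag by auto
    ultimately have "infinite {v. \<rho> v \<in> {1}}" by (rule infinite_super[rotated])
    with run show "\<exists>\<rho>. is_run (input_system base_tiles c) (column_picture x) \<rho> \<and>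
        infinite {v. \<rho> v \<in> {1}}" by blast
  qed
qed

end

section \<open>Undecidability\<close>

lemma less_set_encode:
  assumes "finite A" and "n \<in> A"
  shows "n < set_encode A"
proof -
  have "n < 2 ^ n" by (rule less_exp)
  also have "\<dots> \<le> set_encode A"
    unfolding set_encode_def by (rule member_le_sum) (use assms in auto)
  finally show ?thesis .
qed

lemma state_le_tile_code:
  "q1 \<le> tile_code ((a1, q1), (a2, q2), (a3, q3), (a4, q4))"
  "q2 \<le> tile_code ((a1, q1), (a2, q2), (a3, q3), (a4, q4))"
  "q3 \<le> tile_code ((a1, q1), (a2, q2), (a3, q3), (a4, q4))"
  "q4 \<le> tile_code ((a1, q1), (a2, q2), (a3, q3), (a4, q4))"
  by (simp_all, (meson le_prod_encode_1 le_prod_encode_2 le_trans)+)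

text \<open>
  The code of \<open>input_system T c\<close> when \<open>c\<close> is the code of the tile set \<open>T\<close> itself:
  the sums of codes stand for disjoint unions.
\<close>

definition self_input_code :: "nat \<Rightarrow> nat" where
  "self_input_code c = prod_encode (set_encode {0, 1}, prod_encode (set_encode ((\<lambda>i. i) ` {..<c + 4}),
     prod_encode (c + (set_encode ((\<lambda>i. tile_code (chain_tile i)) ` {..<c}) + 2 ^ tile_code (end_tile c)),
       set_encode {1})))"

lemma computable_self_input_code: "computable1 self_input_code"
proof -
  have "computable1 (\<lambda>i. tile_code (chain_tile i))"
    unfolding chain_tile_def tile_code.simps cell_code.simps
    by (intro computable_prod_encode computable_const computable_Suc computable_proj) simp_all
  moreover have "inj (\<lambda>i. tile_code (chain_tile i))"
    by (rule injI) (simp add: inj_eq[OF inj_tile_code] chain_tile_def)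
  moreover have "computable1 (\<lambda>i. i)" by (rule computable_proj) simp
  ultimately show ?thesis
    unfolding self_input_code_def end_tile_def tile_code.simps cell_code.simps
    by (intro computable_prod_encode computable_const computable_add computable_power2
        computable_set_encode_image) (simp_all add: computable_proj)
qed

section \<open>The system that receives its own tile code as input\<close>

context simulation
begin

definition base_code :: nat where
  "base_code = set_encode (tile_code ` base_tiles)"

abbreviation self_input_system :: "(nat, nat) tiling_system" where
  "self_input_system \<equiv> input_system base_tiles base_code"

text \<open>Pairing dominates its components and a bit mask exceeds its elements, so the code of the
  tile set bounds every state in it.\<close>

lemma base_tile_states:
  assumes "((a1, q1), (a2, q2), (a3, q3), (a4, q4)) \<in> base_tiles"
  shows "q1 < base_code" "q2 < base_code" "q3 < base_code" "q4 < base_code"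
proof -
  have "tile_code ((a1, q1), (a2, q2), (a3, q3), (a4, q4)) < base_code"
    unfolding base_code_def
    by (rule less_set_encode[OF finite_imageI[OF finite_base_tiles] imageI[OF assms]])
  then show "q1 < base_code" "q2 < base_code" "q3 < base_code" "q4 < base_code"
    by (rule le_less_trans[OF state_le_tile_code(1)] le_less_trans[OF state_le_tile_code(2)]
        le_less_trans[OF state_le_tile_code(3)] le_less_trans[OF state_le_tile_code(4)])+
qed

text \<open>Every cell of an active configuration occurs in some inner tile, for instance with all
  letters 0.\<close>

lemma cell_less_base_code:
  assumes "active s"
  shows "cell s y < base_code"
proof -
  have "((Some 0, cell (step s) y), (Some 0, cell (step s) (Suc y)),
      (Some 0, cell s y), (Some 0, cell s (Suc y))) \<in> base_tiles"
    unfolding base_tiles_def inner_tiles_def using assms by blast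
  then show ?thesis by (rule base_tile_states(3))
qed

lemma base_code_pos: "base_code > 0"
proof -
  have "((Some 0, 3), (Some 0, 3), (None, 0), (None, 0)) \<in> base_tiles"
    by (simp add: base_tiles_def)
  from base_tile_states(1)[OF this] show ?thesis by simp
qed

lemma base_tile_letters:
  assumes "((a1, q1), (a2, q2), (a3, q3), (a4, q4)) \<in> base_tiles"
  shows "{a1, a2, a3, a4} \<subseteq> bordered {0, 1}"
proof -
  have "b \<le> Suc 0 \<Longrightarrow> b = 0 \<or> b = Suc 0" for b by auto
  then show ?thesis
    using assms by (auto simp: tile_defs bordered_def)
qed

lemma accepting_self_input_system: "accepting_system (self_input_system, {1})"
proof -
  let ?C = "bordered {0, 1} \<times> {..<base_code + 4}"
  have "t \<in> ?C \<times> ?C \<times> ?C \<times> ?C" if t: "t \<in> base_tiles" for t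
  proof -
    obtain a1 q1 a2 q2 a3 q3 a4 q4 where "t = ((a1, q1), (a2, q2), (a3, q3), (a4, q4))"
      by (metis surj_pair)
    with base_tile_states[of a1 q1 a2 q2 a3 q3 a4 q4] base_tile_letters[of a1 q1 a2 q2 a3 q3 a4 q4] t
    show ?thesis by simp
  qed
  then have "base_tiles \<subseteq> ?C \<times> ?C \<times> ?C \<times> ?C" by blast
  moreover have "chain_tile ` {..<base_code} \<union> {end_tile base_code} \<subseteq> ?C \<times> ?C \<times> ?C \<times> ?C"
    by (auto simp: chain_tile_def end_tile_def bordered_def)
  ultimately show ?thesis
    by (simp add: accepting_system_def tiling_system_def input_system_def)
qed

text \<open>The three groups of tiles are disjoint, so their masks add up and the mask of
  \<open>base_tiles\<close> enters simply as the number \<open>base_code\<close>.\<close>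

lemma system_code_self_input: "system_code (self_input_system, {1}) = self_input_code base_code"
proof -
  let ?chain = "chain_tile ` {..<base_code}" and ?end = "end_tile base_code"
  have "base_tiles \<inter> insert ?end ?chain = {}" by (auto simp: tile_defs)
  then have 1: "tile_code ` base_tiles \<inter> tile_code ` insert ?end ?chain = {}"
    by (simp only: image_Int[OF inj_tile_code, symmetric] image_empty)
  have "?end \<notin> ?chain" by (auto simp: chain_tile_def end_tile_def)
  then have 2: "tile_code ?end \<notin> tile_code ` ?chain"
    by (simp add: inj_image_mem_iff[OF inj_tile_code])
  have "set_encode (tile_code ` (base_tiles \<union> ?chain \<union> {?end})) =
      set_encode (tile_code ` base_tiles \<union> tile_code ` insert ?end ?chain)"
    by (simp add: image_Un)
  also have "\<dots> = base_code + set_encode (tile_code ` insert ?end ?chain)"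
    using 1 finite_base_tiles unfolding base_code_def set_encode_def
    by (intro sum.union_disjoint) auto
  also have "set_encode (tile_code ` insert ?end ?chain) =
      set_encode ((\<lambda>i. tile_code (chain_tile i)) ` {..<base_code}) + 2 ^ tile_code ?end"
    using 2 by (simp add: image_image)
  finally show ?thesis
    by (simp add: self_input_code_def input_system_def)
qed

end

text \<open>Shifting any injection by 4 leaves the reserved values 2 and 3 free.\<close>

lemma exists_simulation: "\<exists>enc. simulation prog enc"
proof -
  have "finite (conts prog [] \<times> Pow (regs prog))"
    by (simp add: finite_conts finite_regs)
  then obtain f :: "program \<times> nat set \<Rightarrow> nat"
    where f: "inj_on f (conts prog [] \<times> Pow (regs prog))"
    using finite_imp_inj_to_nat_seg by blast
  define enc where "enc z = (if z = (prog, {0}) then 2 else if z = (prog, {}) then 3 else f z + 4)"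
    for z
  have "simulation prog enc"
  proof
    show "inj_on enc (conts prog [] \<times> Pow (regs prog))"
      using f by (auto simp: inj_on_def enc_def)
  qed (simp_all add: enc_def)
  then show ?thesis by blast
qed

lemma halting_iff_output_0:
  assumes "runs p r r'"
  shows "(\<exists>t. fst ((step ^^ t) (p @ [While i [Incr i]], r)) = []) \<longleftrightarrow> r' i = 0"
proof -
  let ?loop = "[While i [Incr i]]"
  obtain m where m: "(step ^^ m) (p @ ?loop, r) = (?loop, r')"
    using assms unfolding runs_def by blast
  show ?thesis
  proof
    assume "r' i = 0"
    with m have "fst ((step ^^ Suc m) (p @ ?loop, r)) = []" by simp
    then show "\<exists>t. fst ((step ^^ t) (p @ ?loop, r)) = []" ..
  next
    assume "\<exists>t. fst ((step ^^ t) (p @ ?loop, r)) = []"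
    then obtain t where "fst ((step ^^ t) (p @ ?loop, r)) = []" ..
    moreover have "(step ^^ n) s = s" if "fst s = []" for n and s :: config
      using that by (induction n) (cases s; simp)+
    \<comment> \<open>Halting persists, so it can be observed at a time after the loop was
      entered.\<close>
    ultimately have *: "fst ((step ^^ (m + t)) (p @ ?loop, r)) = []"
      by (simp only: funpow_add comp_apply)
    show "r' i = 0"
    proof (rule ccontr)
      assume nz: "r' i \<noteq> 0"
      \<comment> \<open>Once register \<open>i\<close> is nonzero, the loop only increments it and
        alternates between these two programs.\<close>
      define I where "I s \<longleftrightarrow> (fst s = ?loop \<or> fst s = Incr i # ?loop) \<and> snd s i \<noteq> 0" for s :: config
      have "I (step s)" if "I s" for s
        using that by (cases s) (auto simp: I_def)
      moreover have "I (?loop, r')" using nz by (simp add: I_def)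
      ultimately have "I ((step ^^ n) (?loop, r'))" for n
        by (induction n) simp_all
      from this[of t] m have "I ((step ^^ (t + m)) (p @ ?loop, r))" by (simp add: funpow_add)
      with * show False by (auto simp: I_def add.commute)
    qed
  qed
qed

text \<open>
  The program \<open>prog\<close> consults the supposed decision procedure on its own simulation with its own
  code as input, and halts iff the answer is no.
\<close>

lemma undecidable:
  assumes empty: "R {0, 1} {}"
    and column: "\<And>L. (\<And>x. column_picture x \<in> L \<longleftrightarrow> infinite {j. x j}) \<Longrightarrow> \<not> R {0, 1} L"
  shows "\<not> decision_procedure d {X. accepting_system X} system_code
    (\<lambda>(A, F). R (alphabet A) (Buchi_language (A, F)))"
proof
  assume d: "decision_procedure d {X. accepting_system X} system_code
    (\<lambda>(A, F). R (alphabet A) (Buchi_language (A, F)))"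
  obtain g where g: "\<And>xs. length xs = 1 \<Longrightarrow> rec_eval g xs (self_input_code (xs ! 0))"
    using computable_self_input_code unfolding computable_def by blast
  \<comment> \<open>Input in register 0, where \<open>config\<close> puts it, and output in register
    1, which the final loop tests.\<close>
  have "set [0] \<subseteq> {..<2 :: nat}" "(1 :: nat) < 2" "(1 :: nat) \<notin> set [0]" by auto
  then obtain p where p: "computes p (Comp d [g]) [0] 1 2"
    by (rule implementableE[OF all_implementable])
  define prog where "prog = p @ [While 1 [Incr 1]]"
  obtain enc where "simulation prog enc" using exists_simulation by blast
  then interpret simulation prog enc .
  let ?A = "self_input_system"
  define yes where "yes \<longleftrightarrow> R {0, 1} (Buchi_language (?A, {1}))"
  have alphabet: "alphabet ?A = {0, 1}" by (simp add: input_system_def)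
  have "(?A, {1}) \<in> {X. accepting_system X}" using accepting_self_input_system by simp
  then have "rec_eval d [self_input_code base_code] (if yes then 1 else 0)"
    using bspec[OF d[unfolded decision_procedure_def], of "(?A, {1})"]
    unfolding system_code_self_input prod.case alphabet yes_def by blast
  then have "rec_eval (Comp d [g]) [base_code] (if yes then 1 else 0)"
    using g[of "[base_code]"] by (intro rec_eval.comp[of _ _ "[self_input_code base_code]"]) auto
  then have "rec_eval (Comp d [g]) (map ((\<lambda>_. 0)(0 := base_code)) [0]) (if yes then 1 else 0)"
    by simp
  then obtain r where r: "runs p ((\<lambda>_. 0)(0 := base_code)) r" "r 1 = (if yes then 1 else 0)"
    by (rule computesE[OF p])
  have halting: "(\<exists>t. fst (config base_code t) = []) \<longleftrightarrow> \<not> yes"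
    using halting_iff_output_0[OF r(1), of 1, folded prog_def] r(2) by (simp add: config_def)
  \<comment> \<open>Answer yes makes the program diverge and the language non-recognizable; answer
    no makes it halt and the language empty.\<close>
  show False
  proof (cases yes)
    case True
    then have diverging: "\<And>t. fst (config base_code t) \<noteq> []" using halting by blast
    have "cell s y < base_code + 4" if "active s" for s y
      using cell_less_base_code[OF that, of y] by simp
    then have "\<not> R {0, 1} (Buchi_language (?A, {1}))"
      by (intro column Buchi_language_diverging[OF base_code_pos diverging])
    with True show False by (simp add: yes_def)
  next
    case False
    then obtain t where "fst (config base_code t) = []" using halting by blast
    with empty False show False
      using Buchi_language_halting[OF base_code_pos] by (simp add: yes_def)
  qed
qed

theorem proposition5p4:
  shows "(\<nexists>d. decision_procedure d {X. accepting_system X} system_code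
            (\<lambda>(A, F). E_recognizable (alphabet A) (Buchi_language (A, F)))) \<and>
         (\<nexists>d. decision_procedure d {X. accepting_system X} system_code
            (\<lambda>(A, F). A_recognizable (alphabet A) (Buchi_language (A, F))))"
proof -
  have A: "A_recognizable {0, 1 :: nat} {}" by (rule A_recognizable_empty) simp
  have E: "\<not> E_recognizable {0, 1} L" if "\<And>x. column_picture x \<in> L \<longleftrightarrow> infinite {j. x j}" for L
    by (rule not_E_recognizable) (use that in auto)
  then have "\<not> A_recognizable {0, 1} L"
    if "\<And>x. column_picture x \<in> L \<longleftrightarrow> infinite {j. x j}" for L
    using that A_recognizable_imp_E_recognizable by blast
  from undecidable[of E_recognizable, OF A_recognizable_imp_E_recognizable[OF A] E]
    undecidable[of A_recognizable, OF A this]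
  show ?thesis by blast
qed

end
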